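(* There exists at least one solution $(y^*,u^* )\in Y\times U_{\mathrm{ad}}$ to the parameter calibration problem $$\min_{(y,u)\in Y\times U_{\mathrm{ad}}}J(y,u)\quad\text{subject to } y=(x,v)\text{ solving the interaction system below with parameters }u=(\lambda,A,R).$$
   Context: Consider $N\in\mathbb{N}$ agents with positions $x_i:[0,T]\to\mathbb{R}^2$, velocities $v_i:[0,T]\to\mathbb{R}^2$ and body diameter $d>0$; write $x=(x_1,\dots,x_N)$, $v=(v_1,\dots,v_N)$, $y=(x,v)$. With a relaxation parameter $\tau>0$, given desired velocities $w_i\in\mathcal{C}([0,T],\mathbb{R}^2)$ and given initial data $x_0^i,v_0^i\in\mathbb{R}^2$, the interaction system (posed without boundary conditions) is $$\frac{d}{dt}x_i=v_i,\qquad \frac{d}{dt}v_i=\tau(w_i-v_i)-\frac1N\sum_{j\ne i}M(v_i,v_j)\,K(d,x_i,x_j),\qquad x_i(0)=x_0^i,\ v_i(0)=v_0^i,\quad i=1,\dots,N.$$ The rotation matrix is $$M(v_i,v_j)=\begin{pmatrix}\cos\alpha_{ij}&-\sin\alpha_{ij}\\ \sin\alpha_{ij}&\cos\alpha_{ij}\end{pmatrix},\qquad \alpha_{ij}=\begin{cases}\lambda\arccos\dfrac{v_i\cdot v_j}{\|v_i\|\,\|v_j\|},& v_i\neq0,\ v_j\neq 0,\\ 0,&\text{else,}\end{cases}$$ and the interaction force is the Morse-type force with body size $$K(d,x_i,x_j)=\left(\frac{A}{a}\,e^{\frac{d-\|x_i-x_j\|}{a}}-\frac{R}{r}\,e^{\frac{d-\|x_i-x_j\|}{r}}\right)\frac{x_i-x_j}{\|x_i-x_j\|}$$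 with fixed ranges $a,r>0$ and strengths $A,R$. The standing assumption on the interaction forces is that they are locally Lipschitz and globally bounded with respect to the positions and the velocities; this is taken to hold for the force above. The parameters to be calibrated are $u=(\lambda,A,R)$. For fixed $0<\epsilon\ll1$ and given bounds $A_{\max},R_{\max}$, the admissible set is $U_{\mathrm{ad}}=[-1+\epsilon,1-\epsilon]\times[0,A_{\max}]\times[0,R_{\max}]$. The state space is $Y=H^1([0,T],\mathbb{R}^{2N})\times H^1([0,T],\mathbb{R}^{2N})$. The cost functional is $$J(y,u)=\int_0^T\frac{\sigma_1}{2N}\sum_{i=1}^N\|x_i(t)-x_i^{\mathrm{data}}(t)\|_2^2\,dt+\frac{\sigma_2}{2}\|u-u_{\mathrm{ref}}\|_2^2,$$ where $x_i^{\mathrm{data}}$ are given trajectory data from experiments, $u_{\mathrm{ref}}$ are given reference parameters, and $\sigma_1,\sigma_2$ are weights of the cost functional ($\sigma_2=0$ if no reference values are available). *)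

theory Defs
  imports "HOL-Analysis.Analysis"
begin

section \<open>Sobolev functions on a bounded interval\<close>

definition square_integrable :: "real \<Rightarrow> (real \<Rightarrow> 'a::euclidean_space) \<Rightarrow> bool" where
  "square_integrable T f \<longleftrightarrow>
     f \<in> borel_measurable (lebesgue_on {0..T}) \<and>
     integrable (lebesgue_on {0..T}) (\<lambda>t. (norm (f t))\<^sup>2)"

text \<open>Continuously differentiable test functions with compact support in the open interval
  \<open>(0, T)\<close>, paired with their derivative.\<close>

definition test_function :: "real \<Rightarrow> (real \<Rightarrow> real) \<Rightarrow> (real \<Rightarrow> real) \<Rightarrow> bool" where
  "test_function T \<phi> \<phi>' \<longleftrightarrow>
     (\<forall>t. (\<phi> has_real_derivative \<phi>' t) (at t)) \<and> continuous_on UNIV \<phi>' \<and>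
     (\<exists>S. compact S \<and> S \<subseteq> {0<..<T} \<and> (\<forall>t. t \<notin> S \<longrightarrow> \<phi> t = 0))"

definition has_weak_derivative ::
    "real \<Rightarrow> (real \<Rightarrow> 'a::euclidean_space) \<Rightarrow> (real \<Rightarrow> 'a) \<Rightarrow> bool" where
  "has_weak_derivative T f g \<longleftrightarrow>
     square_integrable T f \<and> square_integrable T g \<and>
     (\<forall>\<phi> \<phi>'. test_function T \<phi> \<phi>' \<longrightarrow>
        (\<integral>t. \<phi>' t *\<^sub>R f t \<partial>lebesgue_on {0..T}) = - (\<integral>t. \<phi> t *\<^sub>R g t \<partial>lebesgue_on {0..T}))"

text \<open>Every class in \<open>H\<^sup>1([0,T])\<close> has exactly one representative that is continuous on
  \<open>[0,T]\<close>. We work with that representative, so that point values such as initial values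
  make sense.\<close>

definition H1 :: "real \<Rightarrow> (real \<Rightarrow> 'a::euclidean_space) set" where
  "H1 T = {f. continuous_on {0..T} f \<and> (\<exists>g. has_weak_derivative T f g)}"

section \<open>The interaction system\<close>

text \<open>Agents are indexed by a finite type, so \<open>N = CARD('n)\<close>; \<open>(x, v)\<close> is a point of
  \<open>\<real>\<^sup>2\<^sup>N \<times> \<real>\<^sup>2\<^sup>N\<close>. Parameters are triples \<open>(\<lambda>, A, R)\<close>, whose product norm is the Euclidean
  norm of \<open>\<real>\<^sup>3\<close>.\<close>

type_synonym 'n state = "(real^2^'n) \<times> (real^2^'n)"
type_synonym 'n trajectory = "(real \<Rightarrow> real^2^'n) \<times> (real \<Rightarrow> real^2^'n)"
type_synonym params = "real \<times> real \<times> real"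

definition turning_angle :: "real \<Rightarrow> real^2 \<Rightarrow> real^2 \<Rightarrow> real" where
  "turning_angle lam vi vj =
     (if vi \<noteq> 0 \<and> vj \<noteq> 0 then lam * arccos ((vi \<bullet> vj) / (norm vi * norm vj)) else 0)"

definition rotation :: "real \<Rightarrow> real^2 \<Rightarrow> real^2 \<Rightarrow> real^2^2" where
  "rotation lam vi vj =
     (let \<alpha> = turning_angle lam vi vj
      in vector [vector [cos \<alpha>, - sin \<alpha>], vector [sin \<alpha>, cos \<alpha>]])"

text \<open>For \<open>xi = xj\<close>, where the formula divides by zero, this evaluates to \<open>0\<close>.\<close>

definition morse_force ::
    "real \<Rightarrow> real \<Rightarrow> real \<Rightarrow> real \<Rightarrow> real \<Rightarrow> real^2 \<Rightarrow> real^2 \<Rightarrow> real^2" where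
  "morse_force a r A R d xi xj =
     (A / a * exp ((d - norm (xi - xj)) / a) - R / r * exp ((d - norm (xi - xj)) / r)) *\<^sub>R
     ((xi - xj) /\<^sub>R norm (xi - xj))"

fun pair_force :: "real \<Rightarrow> real \<Rightarrow> real \<Rightarrow> params \<Rightarrow> 'n::finite \<Rightarrow> 'n \<Rightarrow> 'n state \<Rightarrow> real^2" where
  "pair_force d a r (lam, A, R) i j (x, v) =
     rotation lam (v $ i) (v $ j) *v morse_force a r A R d (x $ i) (x $ j)"

definition acceleration ::
    "real \<Rightarrow> real \<Rightarrow> real \<Rightarrow> real \<Rightarrow> ('n::finite \<Rightarrow> real \<Rightarrow> real^2) \<Rightarrow> params
      \<Rightarrow> real \<Rightarrow> 'n state \<Rightarrow> real^2^'n" where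
  "acceleration \<tau> d a r w u t z =
     (\<chi> i. \<tau> *\<^sub>R (w i t - snd z $ i)
        - (1 / real CARD('n)) *\<^sub>R (\<Sum>j\<in>UNIV - {i}. pair_force d a r u i j z))"

definition state_space :: "real \<Rightarrow> ('n::finite) trajectory set" where
  "state_space T = H1 T \<times> H1 T"

fun solves_system ::
    "real \<Rightarrow> real \<Rightarrow> real \<Rightarrow> real \<Rightarrow> real \<Rightarrow> ('n::finite \<Rightarrow> real \<Rightarrow> real^2)
      \<Rightarrow> ('n \<Rightarrow> real^2) \<Rightarrow> ('n \<Rightarrow> real^2) \<Rightarrow> params \<Rightarrow> 'n trajectory \<Rightarrow> bool" where
  "solves_system T \<tau> d a r w x0 v0 u (x, v) \<longleftrightarrow>
     has_weak_derivative T x v \<and>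
     has_weak_derivative T v (\<lambda>t. acceleration \<tau> d a r w u t (x t, v t)) \<and>
     (\<forall>i. x 0 $ i = x0 i \<and> v 0 $ i = v0 i)"

section \<open>The calibration problem\<close>

definition admissible_params :: "real \<Rightarrow> real \<Rightarrow> real \<Rightarrow> params set" where
  "admissible_params \<epsilon> Amax Rmax = {- 1 + \<epsilon>..1 - \<epsilon>} \<times> {0..Amax} \<times> {0..Rmax}"

definition cost ::
    "real \<Rightarrow> real \<Rightarrow> real \<Rightarrow> ('n::finite \<Rightarrow> real \<Rightarrow> real^2) \<Rightarrow> params
      \<Rightarrow> 'n trajectory \<Rightarrow> params \<Rightarrow> real" where
  "cost T \<sigma>1 \<sigma>2 xdata uref y u =
     (\<integral>t. \<sigma>1 / (2 * real CARD('n)) * (\<Sum>i\<in>UNIV. (norm (fst y t $ i - xdata i t))\<^sup>2)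
        \<partial>lebesgue_on {0..T})
     + \<sigma>2 / 2 * (norm (u - uref))\<^sup>2"

text \<open>The positions and velocities through which the system can pass for parameters in \<open>U\<close>.
  The Morse force jumps where two positions coincide, and the rotation where a velocity vanishes,
  so local Lipschitz continuity on the whole of \<open>\<real>\<^sup>2\<^sup>N \<times> \<real>\<^sup>2\<^sup>N\<close> could hold only in degenerate
  cases. It is therefore required only on the closure of this set, which is implied by the
  requirement on the whole space.\<close>

definition visited_states ::
    "real \<Rightarrow> real \<Rightarrow> real \<Rightarrow> real \<Rightarrow> real \<Rightarrow> ('n::finite \<Rightarrow> real \<Rightarrow> real^2)
      \<Rightarrow> ('n \<Rightarrow> real^2) \<Rightarrow> ('n \<Rightarrow> real^2) \<Rightarrow> params set \<Rightarrow> 'n state set" where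
  "visited_states T \<tau> d a r w x0 v0 U =
     {(x t, v t) | x v u t. t \<in> {0..T} \<and> u \<in> U \<and> (x, v) \<in> state_space T \<and>
        solves_system T \<tau> d a r w x0 v0 u (x, v)}"

end

theory Submission
  imports Defs "HOL-Complex_Analysis.Great_Picard"
begin

text \<open>Direct method. Without interaction (\<open>A = R = 0\<close>) the system is linear and has an explicit
  solution, so the feasible set is nonempty. Along a minimizing sequence the parameters stay in a
  compact box; the Morse force is bounded and Lipschitz in the parameters, uniformly in the state, so
  the accelerations grow at most linearly in the velocity, and the trajectories are uniformly bounded
  and uniformly Lipschitz. By Arzela-Ascoli a subsequence converges uniformly. Its limit runs in the
  closure of the visited states, where the forces are continuous; hence the accelerations converge
  pointwise and the weak equations pass to the limit by dominated convergence, as does the cost.\<close>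

section \<open>Dependence of the forces on the parameters\<close>

text \<open>Two obstacles shape the proof. First, the forces jump where positions coincide or a
  velocity vanishes, and continuity in the state is available only for a fixed parameter and only on
  the closure of the visited states, whereas along a minimizing sequence parameter and state move
  together. The explicit formula decouples them: the discontinuous factors, the unit vector and the
  \<open>arccos\<close>, do not contain the parameters. So the parameter can be replaced by its
  limit with an error uniform in the state, and afterwards the state converges at a fixed parameter.
  Second, solutions satisfy their equations only weakly, so every bound has to be obtained by
  testing. The central tool is a mean value inequality: if the weak derivative of \<open>f\<close>
  is bounded in norm by the derivative of a real function \<open>H\<close>, then the increments of
  \<open>f\<close> are bounded by those of \<open>H\<close>. A linear \<open>H\<close> gives
  Lipschitz bounds; a suitable exponential \<open>H\<close> gives the growth bound for the
  velocities.\<close>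

lemma norm_vec2: "(norm (y :: real^2))\<^sup>2 = (y $ 1)\<^sup>2 + (y $ 2)\<^sup>2"
  by (simp add: norm_vec_def L2_set_def sum_2)

definition rotate2 :: "real \<Rightarrow> real^2 \<Rightarrow> real^2" where
  "rotate2 \<alpha> y = vector [cos \<alpha> * y $ 1 - sin \<alpha> * y $ 2, sin \<alpha> * y $ 1 + cos \<alpha> * y $ 2]"

lemma rotation_mult_vec: "rotation lam p q *v y = rotate2 (turning_angle lam p q) y"
  by (simp add: rotation_def rotate2_def Let_def matrix_vector_mult_def vec_eq_iff forall_2 sum_2)

lemma rotate2_scaleR: "rotate2 \<alpha> (c *\<^sub>R y) = c *\<^sub>R rotate2 \<alpha> y"
  by (simp add: rotate2_def vec_eq_iff forall_2 algebra_simps)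

lemma norm_rotate2: "norm (rotate2 \<alpha> y) = norm y"
proof -
  have "(norm (rotate2 \<alpha> y))\<^sup>2 = ((cos \<alpha>)\<^sup>2 + (sin \<alpha>)\<^sup>2) * (norm y)\<^sup>2"
    unfolding norm_vec2 rotate2_def vector_2 by algebra
  then show ?thesis by simp
qed

lemma abs_cos_diff_le: "\<bar>cos x - cos y\<bar> \<le> \<bar>x - y :: real\<bar>"
proof -
  have "\<bar>cos x - cos y\<bar> = 2 * \<bar>sin ((x + y) / 2)\<bar> * \<bar>sin ((y - x) / 2)\<bar>"
    by (simp add: cos_diff_cos abs_mult)
  also have "\<dots> \<le> 2 * 1 * \<bar>(y - x) / 2\<bar>"
    by (intro mult_mono abs_sin_x_le_abs_x) auto
  finally show ?thesis by simp
qed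

lemma abs_sin_diff_le: "\<bar>sin x - sin y\<bar> \<le> \<bar>x - y :: real\<bar>"
  using abs_cos_diff_le[of "pi/2 - x" "pi/2 - y"] by (simp add: cos_diff)

text \<open>The difference of two rotations of the plane multiplies lengths by the chord between the
  angles. Bounding the sine and cosine parts separately gives the factor \<open>sqrt 2\<close>,
  rounded up to \<open>2\<close>.\<close>

lemma norm_rotate2_diff_le: "norm (rotate2 \<alpha> y - rotate2 \<beta> y) \<le> 2 * \<bar>\<alpha> - \<beta>\<bar> * norm y"
proof -
  have "(norm (rotate2 \<alpha> y - rotate2 \<beta> y))\<^sup>2
      = ((cos \<alpha> - cos \<beta>)\<^sup>2 + (sin \<alpha> - sin \<beta>)\<^sup>2) * (norm y)\<^sup>2"
    unfolding norm_vec2 rotate2_def vector_minus_component vector_2 by algebra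
  also have "\<dots> \<le> ((\<alpha> - \<beta>)\<^sup>2 + (\<alpha> - \<beta>)\<^sup>2) * (norm y)\<^sup>2"
    by (intro mult_right_mono add_mono abs_le_square_iff[THEN iffD1] abs_cos_diff_le abs_sin_diff_le) auto
  also have "\<dots> \<le> (2 * \<bar>\<alpha> - \<beta>\<bar> * norm y)\<^sup>2"
    by (auto simp: power_mult_distrib mult_right_mono)
  finally show ?thesis
    by (rule power2_le_imp_le) simp
qed

text \<open>The angle is linear in its parameter, with slope zero or a value of
  \<open>arccos\<close> in \<open>[0, pi]\<close>. The estimate is therefore uniform in the
  velocities, even across vanishing ones, where the angle jumps.\<close>

lemma abs_turning_angle_diff_le:
  "\<bar>turning_angle lam p q - turning_angle lam' p q\<bar> \<le> pi * \<bar>lam - lam'\<bar>"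
proof (cases "p \<noteq> 0 \<and> q \<noteq> 0")
  case True
  define c where "c = (p \<bullet> q) / (norm p * norm q)"
  have "\<bar>c\<bar> \<le> 1"
    using Cauchy_Schwarz_ineq2[of p q] True by (simp add: c_def divide_le_eq)
  then have "0 \<le> arccos c" "arccos c \<le> pi"
    by (auto intro!: arccos_lbound arccos_ubound)
  then have "\<bar>lam - lam'\<bar> * \<bar>arccos c\<bar> \<le> \<bar>lam - lam'\<bar> * pi"
    by (intro mult_left_mono) auto
  with True show ?thesis
    by (simp add: turning_angle_def c_def[symmetric] left_diff_distrib[symmetric] abs_mult mult.commute)
qed (auto simp: turning_angle_def)

text \<open>For \<open>a > 0\<close> this is the largest value of the Morse factor
  \<open>exp ((d - \<rho>) / a) / a\<close> over all distances \<open>\<rho> \<ge> 0\<close>,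
  attained at \<open>\<rho> = 0\<close>.\<close>

definition exp_bound :: "real \<Rightarrow> real \<Rightarrow> real" where
  "exp_bound d a = exp (d / a) / a"

text \<open>The force is a scalar, linear in \<open>(A, R)\<close>, times a rotated vector of length
  at most one. Changing the scalar first and the angle second weights the rotation error by the
  primed strengths only; with the limit parameters in that place the right-hand side visibly tends
  to zero. It does not depend on \<open>z\<close>.\<close>

lemma pair_force_params_diff_le:
  assumes "a > 0" "r > 0"
  shows "norm (pair_force d a r (lam, A, R) i j z - pair_force d a r (lam', A', R') i j z)
      \<le> exp_bound d a * \<bar>A - A'\<bar> + exp_bound d r * \<bar>R - R'\<bar>
        + 2 * pi * (exp_bound d a * \<bar>A'\<bar> + exp_bound d r * \<bar>R'\<bar>) * \<bar>lam - lam'\<bar>"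
proof -
  obtain x v where z: "z = (x, v)" by fastforce
  define \<rho> where "\<rho> = norm (x $ i - x $ j)"
  define e where "e = (x $ i - x $ j) /\<^sub>R \<rho>"
  define ca where "ca = exp ((d - \<rho>) / a) / a"
  define cr where "cr = exp ((d - \<rho>) / r) / r"
  define \<alpha> where "\<alpha> = turning_angle lam (v $ i) (v $ j)"
  define \<beta> where "\<beta> = turning_angle lam' (v $ i) (v $ j)"
  \<comment> \<open>Not an equality: for coinciding positions the inverse of zero is zero and
    \<open>e = 0\<close>.\<close>
  have e: "norm e \<le> 1" by (cases "\<rho> = 0") (simp_all add: e_def \<rho>_def)
  have \<rho>: "\<rho> \<ge> 0" by (simp add: \<rho>_def)
  have ca: "0 \<le> ca" "ca \<le> exp_bound d a" and cr: "0 \<le> cr" "cr \<le> exp_bound d r"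
    using assms \<rho> by (auto simp: ca_def cr_def exp_bound_def divide_right_mono)
  have pf: "pair_force d a r (lam, A, R) i j z = (A * ca - R * cr) *\<^sub>R rotate2 \<alpha> e"
    "pair_force d a r (lam', A', R') i j z = (A' * ca - R' * cr) *\<^sub>R rotate2 \<beta> e"
    by (simp_all add: z rotation_mult_vec morse_force_def rotate2_scaleR \<rho>_def[symmetric] e_def
        ca_def cr_def \<alpha>_def \<beta>_def)
  have "pair_force d a r (lam, A, R) i j z - pair_force d a r (lam', A', R') i j z
      = ((A - A') * ca - (R - R') * cr) *\<^sub>R rotate2 \<alpha> e
        + (A' * ca - R' * cr) *\<^sub>R (rotate2 \<alpha> e - rotate2 \<beta> e)"
    unfolding pf by (simp add: algebra_simps)
  also have "norm \<dots> \<le> \<bar>(A - A') * ca - (R - R') * cr\<bar> * norm e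
        + \<bar>A' * ca - R' * cr\<bar> * norm (rotate2 \<alpha> e - rotate2 \<beta> e)"
    by (rule order_trans[OF norm_triangle_ineq]) (simp add: norm_rotate2)
  also have "\<dots> \<le> \<bar>(A - A') * ca - (R - R') * cr\<bar> * 1
        + \<bar>A' * ca - R' * cr\<bar> * (2 * (pi * \<bar>lam - lam'\<bar>) * 1)"
  proof (intro add_mono mult_left_mono e)
    have "norm (rotate2 \<alpha> e - rotate2 \<beta> e) \<le> 2 * \<bar>\<alpha> - \<beta>\<bar> * norm e"
      by (rule norm_rotate2_diff_le)
    also have "\<dots> \<le> 2 * (pi * \<bar>lam - lam'\<bar>) * 1"
      unfolding \<alpha>_def \<beta>_def
      by (intro mult_mono abs_turning_angle_diff_le e order_refl) auto
    finally show "norm (rotate2 \<alpha> e - rotate2 \<beta> e) \<le> 2 * (pi * \<bar>lam - lam'\<bar>) * 1" .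
  qed auto
  also have "\<dots> \<le> (exp_bound d a * \<bar>A - A'\<bar> + exp_bound d r * \<bar>R - R'\<bar>)
        + (exp_bound d a * \<bar>A'\<bar> + exp_bound d r * \<bar>R'\<bar>) * (2 * (pi * \<bar>lam - lam'\<bar>) * 1)"
  proof -
    have *: "\<bar>B * ca - S * cr\<bar> \<le> exp_bound d a * \<bar>B\<bar> + exp_bound d r * \<bar>S\<bar>" for B S
    proof -
      have "\<bar>B * ca - S * cr\<bar> \<le> \<bar>B\<bar> * ca + \<bar>S\<bar> * cr"
        using ca cr by (intro order_trans[OF abs_triangle_ineq4]) (simp add: abs_mult)
      also have "\<dots> \<le> \<bar>B\<bar> * exp_bound d a + \<bar>S\<bar> * exp_bound d r"
        using ca cr by (intro add_mono mult_left_mono) auto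
      finally show ?thesis by (simp add: mult.commute)
    qed
    show ?thesis
      using *[of "A - A'" "R - R'"] by (intro add_mono mult_right_mono *) auto
  qed
  finally show ?thesis by (simp add: algebra_simps)
qed

lemma pair_force_zero: "pair_force d a r (lam, 0, 0) i j z = 0"
  by (cases z) (simp add: morse_force_def)

text \<open>Comparison with strengths \<open>0\<close> and the same \<open>lam\<close>: the second
  force vanishes, and so does the rotation term of the estimate.\<close>

lemma norm_pair_force_le:
  assumes "a > 0" "r > 0"
  shows "norm (pair_force d a r (lam, A, R) i j z) \<le> exp_bound d a * \<bar>A\<bar> + exp_bound d r * \<bar>R\<bar>"
  using pair_force_params_diff_le[OF assms, of d lam A R i j z lam 0 0] by (simp add: pair_force_zero)

text \<open>The states \<open>z n\<close> form an arbitrary sequence. This is the uniformity that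
  separates the limit in the parameter from the limit in the state.\<close>

lemma pair_force_params_tendsto:
  assumes "a > 0" "r > 0" and u: "u \<longlonglongrightarrow> u0"
  shows "(\<lambda>n. pair_force d a r (u n) i j (z n) - pair_force d a r u0 i j (z n)) \<longlonglongrightarrow> 0"
proof -
  obtain lam0 A0 R0 where u0: "u0 = (lam0, A0, R0)" using prod_cases3 by blast
  let ?B = "\<lambda>n. exp_bound d a * \<bar>fst (snd (u n)) - A0\<bar> + exp_bound d r * \<bar>snd (snd (u n)) - R0\<bar>
        + 2 * pi * (exp_bound d a * \<bar>A0\<bar> + exp_bound d r * \<bar>R0\<bar>) * \<bar>fst (u n) - lam0\<bar>"
  have lims: "(\<lambda>n. fst (u n)) \<longlonglongrightarrow> lam0" "(\<lambda>n. fst (snd (u n))) \<longlonglongrightarrow> A0"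
    "(\<lambda>n. snd (snd (u n))) \<longlonglongrightarrow> R0"
    using tendsto_fst[OF u] tendsto_fst[OF tendsto_snd[OF u]] tendsto_snd[OF tendsto_snd[OF u]]
    by (simp_all add: u0)
  have "?B \<longlonglongrightarrow> exp_bound d a * \<bar>A0 - A0\<bar> + exp_bound d r * \<bar>R0 - R0\<bar>
        + 2 * pi * (exp_bound d a * \<bar>A0\<bar> + exp_bound d r * \<bar>R0\<bar>) * \<bar>lam0 - lam0\<bar>"
    by (intro tendsto_intros lims)
  then have B: "?B \<longlonglongrightarrow> 0" by simp
  show ?thesis
  proof (rule Lim_null_comparison[OF always_eventually B], intro allI)
    fix n
    show "norm (pair_force d a r (u n) i j (z n) - pair_force d a r u0 i j (z n)) \<le> ?B n"
      using pair_force_params_diff_le[OF assms(1,2), of d "fst (u n)" "fst (snd (u n))" "snd (snd (u n))" i j "z n" lam0 A0 R0]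
      by (simp add: u0)
  qed
qed

section \<open>Weak derivatives\<close>

lemma finite_measure_Icc: "finite_measure (lebesgue_on {a..b::real})"
  by (intro finite_measure_lebesgue_on) auto

lemma integrable_continuous_lebesgue_Icc:
  fixes f :: "real \<Rightarrow> 'a::euclidean_space"
  assumes "continuous_on {a..b} f"
  shows "integrable (lebesgue_on {a..b}) f"
proof -
  obtain B where "\<forall>x\<in>f ` {a..b}. norm x \<le> B"
    using compact_imp_bounded[OF compact_continuous_image[OF assms compact_Icc]]
    unfolding bounded_iff by blast
  then show ?thesis
    using continuous_imp_measurable_on_sets_lebesgue[OF assms]
    by (intro finite_measure.integrable_const_bound[OF finite_measure_Icc, where B = B] AE_I2) auto
qed

lemma square_integrable_bounded:
  assumes "f \<in> borel_measurable (lebesgue_on {0..T})" "\<And>t. t \<in> {0..T} \<Longrightarrow> norm (f t) \<le> B"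
  shows "square_integrable T f"
proof -
  have "(\<lambda>t. (norm (f t))\<^sup>2) \<in> borel_measurable (lebesgue_on {0..T})"
    using assms(1) by measurable
  then show ?thesis
    unfolding square_integrable_def using assms
    by (auto intro!: finite_measure.integrable_const_bound[OF finite_measure_Icc, where B = "B\<^sup>2"] AE_I2
        simp: power_mono)
qed

lemma square_integrable_continuous:
  assumes "continuous_on {0..T} f"
  shows "square_integrable T f"
proof -
  obtain B where "\<forall>x\<in>f ` {0..T}. norm x \<le> B"
    using compact_imp_bounded[OF compact_continuous_image[OF assms compact_Icc]]
    unfolding bounded_iff by blast
  then show ?thesis
    using continuous_imp_measurable_on_sets_lebesgue[OF assms]
    by (intro square_integrable_bounded) auto
qed

lemma test_function_continuous_on:
  assumes "test_function T \<phi> \<phi>'"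
  shows "continuous_on S \<phi>" "continuous_on S \<phi>'"
  using assms unfolding test_function_def
  by (meson DERIV_isCont continuous_at_imp_continuous_on continuous_on_subset subset_UNIV)+

lemma test_function_bounded:
  assumes "test_function T \<phi> \<phi>'"
  obtains C where "\<And>t. t \<in> {0..T} \<Longrightarrow> \<bar>\<phi> t\<bar> \<le> C" "\<And>t. t \<in> {0..T} \<Longrightarrow> \<bar>\<phi>' t\<bar> \<le> C"
proof -
  have "bounded (\<phi> ` {0..T} \<union> \<phi>' ` {0..T})"
    using test_function_continuous_on[OF assms]
    by (auto intro!: compact_imp_bounded compact_continuous_image)
  then show ?thesis
    using that unfolding bounded_iff by (metis UnI1 UnI2 imageI real_norm_def)
qed

lemma test_function_endpoints:
  assumes "test_function T \<phi> \<phi>'"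
  shows "\<phi> 0 = 0" "\<phi> T = 0"
  using assms unfolding test_function_def by (metis greaterThanLessThan_iff less_irrefl subsetD)+

text \<open>Integration by parts; the boundary terms disappear because \<open>\<phi>\<close>
  vanishes at \<open>0\<close> and \<open>T\<close>. This brings classical solutions and comparison
  functions into the weak setting.\<close>

lemma has_weak_derivative_of_vector_derivative:
  fixes f :: "real \<Rightarrow> 'a::euclidean_space"
  assumes "T > 0"
    and deriv: "\<And>t. t \<in> {0..T} \<Longrightarrow> (f has_vector_derivative g t) (at t within {0..T})"
    and cont: "continuous_on {0..T} g"
  shows "has_weak_derivative T f g"
proof -
  have f: "continuous_on {0..T} f"
    by (rule continuous_on_vector_derivative[OF deriv])
  have "(\<integral>t. \<phi>' t *\<^sub>R f t \<partial>lebesgue_on {0..T}) = - (\<integral>t. \<phi> t *\<^sub>R g t \<partial>lebesgue_on {0..T})"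
    if \<phi>: "test_function T \<phi> \<phi>'" for \<phi> \<phi>'
  proof -
    have int: "integrable (lebesgue_on {0..T}) (\<lambda>t. \<phi> t *\<^sub>R g t)"
      "integrable (lebesgue_on {0..T}) (\<lambda>t. \<phi>' t *\<^sub>R f t)"
      by (intro integrable_continuous_lebesgue_Icc continuous_intros test_function_continuous_on[OF \<phi>] f cont)+
    have "((\<lambda>t. \<phi> t *\<^sub>R f t) has_vector_derivative (\<phi> t *\<^sub>R g t + \<phi>' t *\<^sub>R f t)) (at t within {0..T})"
      if "t \<in> {0..T}" for t
    proof (rule has_vector_derivative_scaleR[OF _ deriv[OF that]])
      show "(\<phi> has_real_derivative \<phi>' t) (at t within {0..T})"
        using \<phi> unfolding test_function_def by (meson has_field_derivative_at_within)
    qed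
    then have "((\<lambda>t. \<phi> t *\<^sub>R g t + \<phi>' t *\<^sub>R f t) has_integral (\<phi> T *\<^sub>R f T - \<phi> 0 *\<^sub>R f 0)) {0..T}"
      using \<open>T > 0\<close> by (intro fundamental_theorem_of_calculus) auto
    then have "integral {0..T} (\<lambda>t. \<phi> t *\<^sub>R g t + \<phi>' t *\<^sub>R f t) = 0"
      using test_function_endpoints[OF \<phi>] by (simp add: integral_unique)
    then have "(\<integral>t. \<phi> t *\<^sub>R g t + \<phi>' t *\<^sub>R f t \<partial>lebesgue_on {0..T}) = 0"
      using int by (subst lebesgue_integral_eq_integral) auto
    then show ?thesis
      using int by (simp add: add_eq_0_iff2 add.commute)
  qed
  then show ?thesis
    unfolding has_weak_derivative_def
    using square_integrable_continuous[OF f] square_integrable_continuous[OF cont] by blast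
qed

text \<open>In the defining identity only the test function is differentiated, so pointwise
  convergence of \<open>F\<close> and \<open>G\<close> under a common bound passes to both
  integrals. Pointwise convergence also gives measurability of the limits.\<close>

lemma has_weak_derivative_limit:
  fixes f :: "real \<Rightarrow> 'a::euclidean_space"
  assumes weak: "\<And>n. has_weak_derivative T (F n) (G n)"
    and lim_F: "\<And>t. t \<in> {0..T} \<Longrightarrow> (\<lambda>n. F n t) \<longlonglongrightarrow> f t"
    and lim_G: "\<And>t. t \<in> {0..T} \<Longrightarrow> (\<lambda>n. G n t) \<longlonglongrightarrow> g t"
    and F: "\<And>n t. t \<in> {0..T} \<Longrightarrow> norm (F n t) \<le> B"
    and G: "\<And>n t. t \<in> {0..T} \<Longrightarrow> norm (G n t) \<le> B"
  shows "has_weak_derivative T f g"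
proof -
  let ?M = "lebesgue_on {0..T}"
  have meas: "F n \<in> borel_measurable ?M" "G n \<in> borel_measurable ?M" for n
    using weak[of n] by (auto simp: has_weak_derivative_def square_integrable_def)
  have meas_f: "f \<in> borel_measurable ?M" and meas_g: "g \<in> borel_measurable ?M"
    using borel_measurable_LIMSEQ_metric[of F ?M f] borel_measurable_LIMSEQ_metric[of G ?M g]
    by (auto simp: meas lim_F lim_G)
  have "norm (f t) \<le> B" "norm (g t) \<le> B" if t: "t \<in> {0..T}" for t
    using LIMSEQ_le_const2[OF tendsto_norm[OF lim_F[OF t]]] F[OF t]
      LIMSEQ_le_const2[OF tendsto_norm[OF lim_G[OF t]]] G[OF t] by blast+
  then have sq: "square_integrable T f" "square_integrable T g"
    using meas_f meas_g square_integrable_bounded by blast+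
  have "(\<integral>t. \<phi>' t *\<^sub>R f t \<partial>?M) = - (\<integral>t. \<phi> t *\<^sub>R g t \<partial>?M)" if \<phi>: "test_function T \<phi> \<phi>'" for \<phi> \<phi>'
  proof -
    obtain C where C: "\<And>t. t \<in> {0..T} \<Longrightarrow> \<bar>\<phi> t\<bar> \<le> C" "\<And>t. t \<in> {0..T} \<Longrightarrow> \<bar>\<phi>' t\<bar> \<le> C"
      using test_function_bounded[OF \<phi>] by metis
    have mphi: "\<phi> \<in> borel_measurable ?M" "\<phi>' \<in> borel_measurable ?M"
      by (auto intro!: continuous_imp_measurable_on_sets_lebesgue test_function_continuous_on[OF \<phi>])
    \<comment> \<open>One statement for both sides of the identity: applied to
      \<open>\<phi>'\<close> with \<open>F\<close> and to \<open>\<phi>\<close> with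
      \<open>G\<close>. The constant \<open>C * B\<close> can dominate because the interval has
      finite measure.\<close>
    have lim: "(\<lambda>n. \<integral>t. \<psi> t *\<^sub>R H n t \<partial>?M) \<longlonglongrightarrow> (\<integral>t. \<psi> t *\<^sub>R h t \<partial>?M)"
      if "\<psi> \<in> borel_measurable ?M" "\<And>t. t \<in> {0..T} \<Longrightarrow> \<bar>\<psi> t\<bar> \<le> C"
        "h \<in> borel_measurable ?M" "\<And>n. H n \<in> borel_measurable ?M"
        "\<And>t. t \<in> {0..T} \<Longrightarrow> (\<lambda>n. H n t) \<longlonglongrightarrow> h t" "\<And>n t. t \<in> {0..T} \<Longrightarrow> norm (H n t) \<le> B"
      for \<psi> H and h :: "real \<Rightarrow> 'a"
    proof (rule integral_dominated_convergence[where w = "\<lambda>_. C * B"])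
      show "AE t in ?M. norm (\<psi> t *\<^sub>R H n t) \<le> C * B" for n
      proof (rule AE_I2)
        fix t assume "t \<in> space ?M"
        then have "t \<in> {0..T}" by simp
        then show "norm (\<psi> t *\<^sub>R H n t) \<le> C * B"
          using that(2)[of t] that(6)[of t n] by (auto intro!: mult_mono)
      qed
    qed (use that in \<open>auto intro!: tendsto_intros AE_I2\<close>)
    have l1: "(\<lambda>n. \<integral>t. \<phi>' t *\<^sub>R F n t \<partial>?M) \<longlonglongrightarrow> (\<integral>t. \<phi>' t *\<^sub>R f t \<partial>?M)"
      using mphi C meas_f meas lim_F F by (intro lim) auto
    have l2: "(\<lambda>n. \<integral>t. \<phi> t *\<^sub>R G n t \<partial>?M) \<longlonglongrightarrow> (\<integral>t. \<phi> t *\<^sub>R g t \<partial>?M)"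
      using mphi C meas_g meas lim_G G by (intro lim) auto
    have "(\<integral>t. \<phi>' t *\<^sub>R F n t \<partial>?M) = - (\<integral>t. \<phi> t *\<^sub>R G n t \<partial>?M)" for n
      using weak[of n] \<phi> by (simp add: has_weak_derivative_def)
    with l1 show ?thesis
      using LIMSEQ_unique[OF _ tendsto_minus[OF l2]] by simp
  qed
  then show ?thesis
    using sq by (simp add: has_weak_derivative_def)
qed

section \<open>Smoothed indicators of intervals and the kernels they differentiate to\<close>

text \<open>At the kink the difference quotient is at most \<open>\<bar>h\<bar>\<close>, so
  truncated squares are continuously differentiable. Test functions are thus obtained as quadratic
  splines with piecewise linear derivative.\<close>

lemma has_real_derivative_max_0_power2:
  "((\<lambda>x. (max 0 x)\<^sup>2) has_real_derivative 2 * max 0 x) (at x)"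
proof -
  consider "x > 0" | "x < 0" | "x = 0" by linarith
  then show ?thesis
  proof cases
    case 1
    have "((\<lambda>x. x\<^sup>2) has_real_derivative 2 * x) (at x)"
      by (auto intro!: derivative_eq_intros)
    then have "((\<lambda>x. (max 0 x)\<^sup>2) has_real_derivative 2 * x) (at x)"
      by (rule has_field_derivative_transform_within_open[where S = "{0<..}"]) (use 1 in auto)
    then show ?thesis using 1 by simp
  next
    case 2
    have "((\<lambda>x. 0) has_real_derivative 0) (at x)" by simp
    then have "((\<lambda>x. (max 0 x)\<^sup>2) has_real_derivative 0) (at x)"
      by (rule has_field_derivative_transform_within_open[where S = "{..<0}"]) (use 2 in auto)
    then show ?thesis using 2 by simp
  next
    case 3
    have "(\<lambda>h. (max 0 h)\<^sup>2 / h) \<midarrow>0\<rightarrow> (0::real)"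
    proof (rule Lim_null_comparison)
      show "\<forall>\<^sub>F h in at 0. norm ((max 0 h)\<^sup>2 / h) \<le> \<bar>h\<bar>"
        by (intro always_eventually) (auto simp: max_def power2_eq_square)
      show "(\<lambda>h. \<bar>h\<bar>) \<midarrow>0\<rightarrow> (0::real)"
        by (rule tendsto_rabs_zero) (rule tendsto_ident_at)
    qed
    then show ?thesis using 3 by (simp add: DERIV_def)
  qed
qed

text \<open>A continuously differentiable step from \<open>0\<close> to \<open>1\<close> on \<open>[0, 1]\<close>, whose derivative is a hat function.\<close>

definition ramp :: "real \<Rightarrow> real" where
  "ramp x = 2 * ((max 0 x)\<^sup>2 - 2 * (max 0 (x - 1/2))\<^sup>2 + (max 0 (x - 1))\<^sup>2)"

definition ramp' :: "real \<Rightarrow> real" where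
  "ramp' x = 4 * (max 0 x - 2 * max 0 (x - 1/2) + max 0 (x - 1))"

lemma DERIV_ramp: "(ramp has_real_derivative ramp' x) (at x)"
proof -
  have shift: "((\<lambda>x. (max 0 (x - c))\<^sup>2) has_real_derivative 2 * max 0 (x - c)) (at x)" for c :: real
    by (rule DERIV_chain2[where g = "\<lambda>x. x - c", OF has_real_derivative_max_0_power2, THEN DERIV_cong])
      (auto intro!: derivative_eq_intros)
  show ?thesis
    unfolding ramp_def[abs_def]
    by (rule DERIV_cmult[OF DERIV_add[OF DERIV_diff[OF has_real_derivative_max_0_power2
            DERIV_cmult[OF shift]] shift], THEN DERIV_cong]) (simp add: ramp'_def algebra_simps)
qed

lemma DERIV_ramp_scaled:
  assumes "h \<noteq> 0"
  shows "((\<lambda>x. ramp ((x - c) / h)) has_real_derivative ramp' ((x - c) / h) / h) (at x within S)"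
  by (rule DERIV_chain2[where g = "\<lambda>x. (x - c) / h", OF DERIV_ramp, THEN DERIV_cong])
    (use assms in \<open>auto intro!: derivative_eq_intros\<close>)

lemma continuous_on_ramp' [continuous_intros]:
  "continuous_on S f \<Longrightarrow> continuous_on S (\<lambda>x. ramp' (f x))"
  unfolding ramp'_def by (intro continuous_intros)

lemma ramp_le_0: "x \<le> 0 \<Longrightarrow> ramp x = 0"
  by (simp add: ramp_def)

lemma ramp_ge_1: "x \<ge> 1 \<Longrightarrow> ramp x = 1"
  by (simp add: ramp_def power2_eq_square algebra_simps)

lemma ramp'_nonneg: "ramp' x \<ge> 0"
  by (auto simp: ramp'_def max_def)

lemma ramp'_eq_0: "x \<le> 0 \<or> x \<ge> 1 \<Longrightarrow> ramp' x = 0"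
  by (auto simp: ramp'_def max_def)

lemma ramp_mono: "x \<le> y \<Longrightarrow> ramp x \<le> ramp y"
  by (rule DERIV_nonneg_imp_nondecreasing) (use DERIV_ramp ramp'_nonneg in blast)+

text \<open>A smoothed indicator: one ramp rises on \<open>[s, s + h]\<close>, the subtracted one on
  \<open>[t, t + h]\<close>. Left of \<open>s\<close> both are \<open>0\<close>, right of
  \<open>t + h\<close> both are \<open>1\<close> and cancel, so the support stays inside the open
  interval.\<close>

lemma test_function_ramp_diff:
  assumes "0 < s" "s \<le> t" "h > 0" "t + h < T"
  shows "test_function T (\<lambda>x. ramp ((x - s) / h) - ramp ((x - t) / h))
     (\<lambda>x. ramp' ((x - s) / h) / h - ramp' ((x - t) / h) / h)"
proof -
  have supp: "ramp ((x - s) / h) - ramp ((x - t) / h) = 0" if "x \<notin> {s..t + h}" for x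
  proof (cases "x < s")
    case True
    then show ?thesis
      using assms by (simp add: ramp_le_0 divide_le_0_iff)
  next
    case False
    then have "(x - s) / h \<ge> 1" "(x - t) / h \<ge> 1"
      using assms that by auto
    then show ?thesis by (simp add: ramp_ge_1)
  qed
  show ?thesis
    unfolding test_function_def
  proof (intro conjI allI)
    show "continuous_on UNIV (\<lambda>x. ramp' ((x - s) / h) / h - ramp' ((x - t) / h) / h)"
      using \<open>h > 0\<close> by (intro continuous_intros) auto
    show "\<exists>S. compact S \<and> S \<subseteq> {0<..<T} \<and>
        (\<forall>x. x \<notin> S \<longrightarrow> ramp ((x - s) / h) - ramp ((x - t) / h) = 0)"
      using assms supp by (intro exI[of _ "{s..t + h}"]) auto
  qed (use \<open>h > 0\<close> in \<open>auto intro!: DERIV_diff DERIV_ramp_scaled\<close>)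
qed

text \<open>The functions \<open>ramp' ((x - s) / h n) / h n\<close> form an approximate identity:
  nonnegative, of mass one, supported in \<open>[s, s + h n]\<close>. The support lies to the right
  of \<open>s\<close>, hence the condition \<open>s < T\<close>.\<close>

lemma integral_ramp'_approximates_point:
  fixes f :: "real \<Rightarrow> 'a::euclidean_space"
  assumes f: "continuous_on {0..T} f" and s: "0 \<le> s" "s < T"
    and h: "\<And>n. h n > 0" "h \<longlonglongrightarrow> 0"
  shows "(\<lambda>n. \<integral>x. (ramp' ((x - s) / h n) / h n) *\<^sub>R f x \<partial>lebesgue_on {0..T}) \<longlonglongrightarrow> f s"
proof (rule tendstoI)
  fix e :: real assume "e > 0"
  let ?M = "lebesgue_on {0..T}"
  obtain \<delta> where \<delta>: "\<delta> > 0" "\<And>x. x \<in> {0..T} \<Longrightarrow> dist x s < \<delta> \<Longrightarrow> dist (f x) (f s) < e / 2"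
    using f s \<open>e > 0\<close> unfolding continuous_on_iff by (metis atLeastAtMost_iff half_gt_zero less_imp_le)
  \<comment> \<open>Below \<open>\<delta>\<close> the kernel only sees points where \<open>f\<close>
    is close to \<open>f s\<close>; below \<open>T - s\<close> its whole mass lies in
    \<open>[0, T]\<close>.\<close>
  have "eventually (\<lambda>n. h n < min \<delta> (T - s)) sequentially"
    using h(2) \<delta>(1) s by (intro order_tendstoD) auto
  then show "eventually (\<lambda>n. dist (\<integral>x. (ramp' ((x - s) / h n) / h n) *\<^sub>R f x \<partial>?M) (f s) < e) sequentially"
  proof eventually_elim
    case (elim n)
    define \<rho> where "\<rho> x = ramp' ((x - s) / h n) / h n" for x
    have hn: "h n > 0" by (rule h)
    have \<rho>_cont: "continuous_on {0..T} \<rho>"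
      unfolding \<rho>_def using hn by (intro continuous_intros) auto
    have "((\<lambda>x. ramp ((x - s) / h n)) has_vector_derivative \<rho> x) (at x within {0..T})" for x
      using DERIV_ramp_scaled hn by (simp add: \<rho>_def has_real_derivative_iff_has_vector_derivative[symmetric])
    then have "(\<rho> has_integral (ramp ((T - s) / h n) - ramp ((0 - s) / h n))) {0..T}"
      using s by (intro fundamental_theorem_of_calculus) auto
    moreover have "ramp ((T - s) / h n) = 1" "ramp ((0 - s) / h n) = 0"
      using elim hn s by (auto intro!: ramp_ge_1 ramp_le_0 simp: divide_nonpos_pos)
    ultimately have "integral {0..T} \<rho> = 1"
      by (simp add: integral_unique)
    then have \<rho>_int: "(\<integral>x. \<rho> x \<partial>?M) = 1"
      using integrable_continuous_lebesgue_Icc[OF \<rho>_cont]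
      by (subst lebesgue_integral_eq_integral) auto
    have int: "integrable ?M (\<lambda>x. \<rho> x *\<^sub>R f x)" "integrable ?M (\<lambda>x. \<rho> x *\<^sub>R f s)"
      "integrable ?M (\<lambda>x. \<rho> x * (e / 2))"
      by (intro integrable_continuous_lebesgue_Icc continuous_intros \<rho>_cont f)+
    have "(\<integral>x. \<rho> x *\<^sub>R f x \<partial>?M) - f s = (\<integral>x. \<rho> x *\<^sub>R f x \<partial>?M) - (\<integral>x. \<rho> x *\<^sub>R f s \<partial>?M)"
      using \<rho>_int integrable_continuous_lebesgue_Icc[OF \<rho>_cont] by simp
    also have "\<dots> = (\<integral>x. \<rho> x *\<^sub>R f x - \<rho> x *\<^sub>R f s \<partial>?M)"
      using int by simp
    finally have "norm ((\<integral>x. \<rho> x *\<^sub>R f x \<partial>?M) - f s) \<le> (\<integral>x. norm (\<rho> x *\<^sub>R f x - \<rho> x *\<^sub>R f s) \<partial>?M)"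
      by simp
    also have "\<dots> \<le> (\<integral>x. \<rho> x * (e / 2) \<partial>?M)"
    proof (rule integral_mono)
      fix x assume "x \<in> space ?M"
      then have x: "x \<in> {0..T}" by simp
      show "norm (\<rho> x *\<^sub>R f x - \<rho> x *\<^sub>R f s) \<le> \<rho> x * (e / 2)"
      proof (cases "dist x s < \<delta>")
        case True
        then have "norm (f x - f s) \<le> e / 2"
          using \<delta>(2)[OF x True] by (simp add: dist_norm)
        moreover have "\<rho> x \<ge> 0" using hn ramp'_nonneg by (simp add: \<rho>_def)
        ultimately show ?thesis
          unfolding scaleR_diff_right[symmetric] norm_scaleR by (intro mult_mono) auto
      next
        case False
        have "(x - s) / h n \<le> 0 \<or> (x - s) / h n \<ge> 1"
        proof (cases "x \<le> s")
          case False
          with \<open>\<not> dist x s < \<delta>\<close> elim hn show ?thesis by (simp add: dist_real_def)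
        qed (use hn in \<open>simp add: divide_nonpos_pos\<close>)
        then have "\<rho> x = 0" by (simp add: \<rho>_def ramp'_eq_0)
        then show ?thesis by simp
      qed
    qed (use int in auto)
    also have "\<dots> = e / 2"
      using \<rho>_int by simp
    finally show ?case
      using \<open>e > 0\<close> by (simp add: dist_norm \<rho>_def)
  qed
qed

text \<open>Both weak equations, for \<open>f\<close> and for \<open>H\<close>, are tested with smoothed indicators of \<open>[s, t]\<close>.\<close>

lemma weak_mean_value_inequality_interior:
  fixes f :: "real \<Rightarrow> 'a::euclidean_space" and H :: "real \<Rightarrow> real"
  assumes f: "continuous_on {0..T} f" and weak: "has_weak_derivative T f g"
    and h: "continuous_on {0..T} h"
    and H: "\<And>t. t \<in> {0..T} \<Longrightarrow> (H has_vector_derivative h t) (at t within {0..T})"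
    and bound: "\<And>t. t \<in> {0..T} \<Longrightarrow> norm (g t) \<le> h t"
    and st: "0 < s" "s \<le> t" "t < T"
  shows "norm (f t - f s) \<le> H t - H s"
proof -
  let ?M = "lebesgue_on {0..T}"
  \<comment> \<open>The denominator is at least \<open>2\<close>, so \<open>t + \<eta> n < T\<close>
    is strict already for \<open>n = 0\<close>.\<close>
  define \<eta> where "\<eta> n = (T - t) / real (n + 2)" for n
  have \<eta>: "\<eta> n > 0" "t + \<eta> n < T" for n
  proof -
    show "\<eta> n > 0" using st by (simp add: \<eta>_def)
    have "(T - t) / real (n + 2) < (T - t) / 1"
      using st by (intro divide_strict_left_mono) auto
    then show "t + \<eta> n < T" by (simp add: \<eta>_def)
  qed
  have \<eta>_lim: "\<eta> \<longlonglongrightarrow> 0"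
    unfolding \<eta>_def using LIMSEQ_ignore_initial_segment[OF lim_const_over_n[of "T - t"], of 2] by simp
  define \<phi> where "\<phi> n x = ramp ((x - s) / \<eta> n) - ramp ((x - t) / \<eta> n)" for n x
  define \<phi>' where "\<phi>' n x = ramp' ((x - s) / \<eta> n) / \<eta> n - ramp' ((x - t) / \<eta> n) / \<eta> n" for n x
  have test: "test_function T (\<phi> n) (\<phi>' n)" for n
    unfolding \<phi>_def[abs_def] \<phi>'_def[abs_def] using st \<eta> by (intro test_function_ramp_diff) auto
  have nonneg: "\<phi> n x \<ge> 0" for n x
    unfolding \<phi>_def using st \<eta>[of n] by (auto intro!: ramp_mono divide_right_mono)
  have "T > 0" using st by simp
  have H_cont: "continuous_on {0..T} H"
    by (rule continuous_on_vector_derivative[OF H])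
  have H_weak: "has_weak_derivative T H h"
    by (rule has_weak_derivative_of_vector_derivative[OF \<open>T > 0\<close> H h])
  \<comment> \<open>\<open>\<phi>' n\<close> is a kernel at \<open>s\<close> minus a kernel at
    \<open>t\<close>. The target space is left general because both \<open>f\<close> and the
    real-valued \<open>H\<close> are inserted.\<close>
  have lim: "(\<lambda>n. \<integral>x. \<phi>' n x *\<^sub>R k x \<partial>?M) \<longlonglongrightarrow> k s - k t"
    if k: "continuous_on {0..T} k" for k :: "real \<Rightarrow> 'b::euclidean_space"
  proof -
    have int: "integrable ?M (\<lambda>x. (ramp' ((x - c) / \<eta> n) / \<eta> n) *\<^sub>R k x)" for c n
      using \<eta>(1)[of n] by (intro integrable_continuous_lebesgue_Icc continuous_intros k) auto
    have "(\<lambda>n. (\<integral>x. (ramp' ((x - s) / \<eta> n) / \<eta> n) *\<^sub>R k x \<partial>?M)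
             - (\<integral>x. (ramp' ((x - t) / \<eta> n) / \<eta> n) *\<^sub>R k x \<partial>?M)) \<longlonglongrightarrow> k s - k t"
      using st \<eta> \<eta>_lim by (intro tendsto_diff integral_ramp'_approximates_point[OF k]) auto
    then show ?thesis
      unfolding \<phi>'_def scaleR_diff_left using int by simp
  qed
  have "norm (\<integral>x. \<phi>' n x *\<^sub>R f x \<partial>?M) \<le> - (\<integral>x. \<phi>' n x *\<^sub>R H x \<partial>?M)" for n
  proof -
    have "norm (\<integral>x. \<phi>' n x *\<^sub>R f x \<partial>?M) = norm (\<integral>x. \<phi> n x *\<^sub>R g x \<partial>?M)"
      using weak test[of n] by (simp add: has_weak_derivative_def)
    also have "\<dots> \<le> (\<integral>x. norm (\<phi> n x *\<^sub>R g x) \<partial>?M)"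
      by (rule integral_norm_bound)
    also have "\<dots> \<le> (\<integral>x. \<phi> n x *\<^sub>R h x \<partial>?M)"
    proof (rule integral_mono)
      show int: "integrable ?M (\<lambda>x. \<phi> n x *\<^sub>R h x)"
        by (intro integrable_continuous_lebesgue_Icc continuous_intros h test_function_continuous_on[OF test])
      show le: "norm (\<phi> n x *\<^sub>R g x) \<le> \<phi> n x *\<^sub>R h x" if "x \<in> space ?M" for x
        using bound[of x] nonneg[of n x] that by (simp add: mult_left_mono)
      have "\<phi> n \<in> borel_measurable ?M" "g \<in> borel_measurable ?M"
        using weak by (auto simp: has_weak_derivative_def square_integrable_def
            intro!: continuous_imp_measurable_on_sets_lebesgue test_function_continuous_on[OF test])
      then show "integrable ?M (\<lambda>x. norm (\<phi> n x *\<^sub>R g x))"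
        using order_trans[OF le abs_ge_self]
        by (intro Bochner_Integration.integrable_bound[OF int]) (auto intro!: AE_I2)
    qed
    also have "\<dots> = - (\<integral>x. \<phi>' n x *\<^sub>R H x \<partial>?M)"
      using H_weak test[of n] by (simp add: has_weak_derivative_def)
    finally show ?thesis .
  qed
  then have "norm (f s - f t) \<le> - (H s - H t)"
    using LIMSEQ_le[OF tendsto_norm[OF lim[OF f]] tendsto_minus[OF lim[OF H_cont]]] by blast
  then show ?thesis by (simp add: norm_minus_commute)
qed

text \<open>Test functions vanish near \<open>0\<close> and \<open>T\<close>, so these endpoints are
  reached by shrinking the interval inwards and using continuity of \<open>f\<close> and
  \<open>H\<close>.\<close>

lemma weak_mean_value_inequality:
  fixes f :: "real \<Rightarrow> 'a::euclidean_space" and H :: "real \<Rightarrow> real"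
  assumes f: "continuous_on {0..T} f" and weak: "has_weak_derivative T f g"
    and h: "continuous_on {0..T} h"
    and H: "\<And>t. t \<in> {0..T} \<Longrightarrow> (H has_vector_derivative h t) (at t within {0..T})"
    and bound: "\<And>t. t \<in> {0..T} \<Longrightarrow> norm (g t) \<le> h t"
    and st: "0 \<le> s" "s \<le> t" "t \<le> T"
  shows "norm (f t - f s) \<le> H t - H s"
proof (cases "s = t")
  case False
  then have "s < t" using st by simp
  \<comment> \<open>With denominator at least \<open>2\<close> the shrunken endpoints
    \<open>s + \<eta> n\<close> and \<open>t - \<eta> n\<close> keep their order.\<close>
  define \<eta> where "\<eta> n = (t - s) / real (n + 2)" for n
  have \<eta>: "\<eta> n > 0" "2 * \<eta> n \<le> t - s" for n
  proof -
    show "\<eta> n > 0" using \<open>s < t\<close> by (simp add: \<eta>_def)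
    have "(t - s) / real (n + 2) \<le> (t - s) / 2"
      using \<open>s < t\<close> by (intro divide_left_mono) auto
    then have "\<eta> n \<le> (t - s) / 2" by (simp only: \<eta>_def)
    then show "2 * \<eta> n \<le> t - s" by simp
  qed
  have \<eta>_lim: "\<eta> \<longlonglongrightarrow> 0"
    unfolding \<eta>_def using LIMSEQ_ignore_initial_segment[OF lim_const_over_n[of "t - s"], of 2] by simp
  have in_Icc: "s + \<eta> n \<in> {0..T}" "t - \<eta> n \<in> {0..T}" for n
    using \<eta>[of n] st by auto
  have "(\<lambda>n. s + \<eta> n) \<longlonglongrightarrow> s + 0" "(\<lambda>n. t - \<eta> n) \<longlonglongrightarrow> t - 0"
    by (intro tendsto_intros \<eta>_lim)+
  then have lims: "(\<lambda>n. s + \<eta> n) \<longlonglongrightarrow> s" "(\<lambda>n. t - \<eta> n) \<longlonglongrightarrow> t" by simp_all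
  have lim: "(\<lambda>n. k (t - \<eta> n) - k (s + \<eta> n)) \<longlonglongrightarrow> k t - k s"
    if k: "continuous_on {0..T} k" for k :: "real \<Rightarrow> 'b::euclidean_space"
    using st in_Icc
    by (intro tendsto_diff continuous_on_tendsto_compose[OF k] lims) auto
  have "norm (f (t - \<eta> n) - f (s + \<eta> n)) \<le> H (t - \<eta> n) - H (s + \<eta> n)" for n
    using \<eta>[of n] st by (intro weak_mean_value_inequality_interior[OF f weak h H bound]) auto
  moreover have "continuous_on {0..T} H"
    by (rule continuous_on_vector_derivative[OF H])
  ultimately show ?thesis
    using LIMSEQ_le[OF tendsto_norm[OF lim[OF f]] lim] by blast
qed simp

text \<open>The mean value inequality with a linear comparison function of slope \<open>L\<close>;
  it supplies the equicontinuity for Arzela-Ascoli.\<close>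

lemma weak_derivative_bounded_imp_lipschitz:
  fixes f :: "real \<Rightarrow> 'a::euclidean_space"
  assumes "continuous_on {0..T} f" "has_weak_derivative T f g"
    and "\<And>t. t \<in> {0..T} \<Longrightarrow> norm (g t) \<le> L" and "s \<in> {0..T}" "t \<in> {0..T}"
  shows "norm (f t - f s) \<le> L * \<bar>t - s\<bar>"
proof -
  have *: "norm (f t - f s) \<le> L * t - L * s" if "0 \<le> s" "s \<le> t" "t \<le> T" for s t
    using assms(1-3) that
    by (intro weak_mean_value_inequality[where g = g and h = "\<lambda>_. L" and H = "\<lambda>t. L * t"])
      (auto intro!: derivative_eq_intros)
  show ?thesis
    using *[of s t] *[of t s] assms(4,5)
    by (cases "s \<le> t") (auto simp: norm_minus_commute right_diff_distrib)
qed

text \<open>Gronwall's inequality is replaced by looking at a maximum point of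
  \<open>exp (- 2 * \<tau> * t) * norm (f t)\<close>.\<close>

lemma weak_derivative_linear_growth_bound:
  fixes f :: "real \<Rightarrow> 'a::euclidean_space"
  assumes "T > 0" "\<tau> > 0" "C \<ge> 0"
    and f: "continuous_on {0..T} f" and weak: "has_weak_derivative T f g"
    and growth: "\<And>t. t \<in> {0..T} \<Longrightarrow> norm (g t) \<le> C + \<tau> * norm (f t)"
    and t: "t \<in> {0..T}"
  shows "norm (f t) \<le> 2 * (norm (f 0) + C * T) * exp (2 * \<tau> * T)"
proof -
  define k where "k t = exp (- (2 * \<tau> * t)) * norm (f t)" for t
  have "continuous_on {0..T} k"
    unfolding k_def by (intro continuous_intros f)
  then obtain s where s: "s \<in> {0..T}" "\<And>t. t \<in> {0..T} \<Longrightarrow> k t \<le> k s"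
    using continuous_attains_sup[of "{0..T}" k] \<open>T > 0\<close> by auto
  define m where "m = k s"
  have f_eq: "norm (f t) = k t * exp (2 * \<tau> * t)" for t
    by (simp add: k_def exp_minus)
  have f_le: "norm (f t) \<le> m * exp (2 * \<tau> * t)" if "t \<in> {0..T}" for t
    using s(2)[OF that] unfolding f_eq m_def by simp
  have "m \<ge> 0" by (simp add: m_def k_def)
  \<comment> \<open>Since \<open>norm (f t) \<le> m * exp (2 * \<tau> * t)\<close>, the growth
    condition bounds \<open>g\<close> by the derivative of
    \<open>C * t + m / 2 * exp (2 * \<tau> * t)\<close>. The rate \<open>2 * \<tau>\<close>, twice
    the growth constant, produces the factor \<open>1 / 2\<close>; at the maximum point
    \<open>s\<close> that term is half of \<open>norm (f s)\<close> and is absorbed on the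
    left.\<close>
  have "norm (f s - f 0) \<le> (C * s + m / 2 * exp (2 * \<tau> * s)) - (C * 0 + m / 2 * exp (2 * \<tau> * 0))"
  proof (rule weak_mean_value_inequality[OF f weak, where h = "\<lambda>t. C + \<tau> * m * exp (2 * \<tau> * t)"])
    show "norm (g t) \<le> C + \<tau> * m * exp (2 * \<tau> * t)" if "t \<in> {0..T}" for t
    proof -
      have "\<tau> * norm (f t) \<le> \<tau> * (m * exp (2 * \<tau> * t))"
        using \<open>\<tau> > 0\<close> by (intro mult_left_mono f_le that) auto
      with growth[OF that] show ?thesis
        unfolding mult.assoc by linarith
    qed
    show "((\<lambda>t. C * t + m / 2 * exp (2 * \<tau> * t)) has_vector_derivative
        C + \<tau> * m * exp (2 * \<tau> * t)) (at t within {0..T})" for t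
      unfolding has_real_derivative_iff_has_vector_derivative[symmetric]
      by (auto intro!: derivative_eq_intros)
  qed (use s in \<open>auto intro!: continuous_intros\<close>)
  then have "norm (f s) - norm (f 0) \<le> C * s + m / 2 * exp (2 * \<tau> * s)"
    using norm_triangle_ineq2[of "f s" "f 0"] \<open>m \<ge> 0\<close> by simp
  then have "m * exp (2 * \<tau> * s) \<le> 2 * (norm (f 0) + C * s)"
    using f_eq[of s] by (simp add: m_def algebra_simps)
  moreover have "m * 1 \<le> m * exp (2 * \<tau> * s)"
    using s(1) \<open>\<tau> > 0\<close> \<open>m \<ge> 0\<close> by (intro mult_left_mono) auto
  moreover have "C * s \<le> C * T"
    using s(1) \<open>C \<ge> 0\<close> by (intro mult_left_mono) auto
  ultimately have m: "m \<le> 2 * (norm (f 0) + C * T)"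
    unfolding distrib_left mult_1_right by linarith
  have "norm (f t) \<le> m * exp (2 * \<tau> * t)" by (rule f_le[OF t])
  also have "\<dots> \<le> 2 * (norm (f 0) + C * T) * exp (2 * \<tau> * T)"
    using m \<open>m \<ge> 0\<close> t \<open>\<tau> > 0\<close> by (intro mult_mono) auto
  finally show ?thesis .
qed

section \<open>Existence of an optimal calibration\<close>

lemma norm_vec_le_sum: "norm (x :: 'a::real_normed_vector ^ 'n) \<le> (\<Sum>i\<in>UNIV. norm (x $ i))"
  unfolding norm_vec_def by (rule L2_set_le_sum) simp

lemma cost_nonneg:
  assumes "\<sigma>1 \<ge> 0" "\<sigma>2 \<ge> 0"
  shows "cost T \<sigma>1 \<sigma>2 xdata uref y u \<ge> 0"
  unfolding cost_def using assms
  by (intro add_nonneg_nonneg Bochner_Integration.integral_nonneg mult_nonneg_nonneg sum_nonneg) auto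

text \<open>The data are square integrable but possibly unbounded, so the dominating function is not
  a constant: it comes from \<open>(p + q)^2 \<le> 2 * p^2 + 2 * q^2\<close>, with the uniform bound
  on the positions for \<open>p\<close> and the data for \<open>q\<close>.\<close>

lemma cost_tendsto:
  fixes X :: "nat \<Rightarrow> real \<Rightarrow> real^2^'n::finite"
  assumes "\<sigma>1 \<ge> 0" and xdata: "\<And>i. square_integrable T (xdata i)"
    and X: "\<And>n. continuous_on {0..T} (X n)" "\<And>n t. t \<in> {0..T} \<Longrightarrow> norm (X n t) \<le> B"
    and x: "continuous_on {0..T} x"
    and lim: "\<And>t. t \<in> {0..T} \<Longrightarrow> (\<lambda>n. X n t) \<longlonglongrightarrow> x t" and u: "U \<longlonglongrightarrow> u"
  shows "(\<lambda>n. cost T \<sigma>1 \<sigma>2 xdata uref (X n, V n) (U n)) \<longlonglongrightarrow> cost T \<sigma>1 \<sigma>2 xdata uref (x, v) u"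
proof -
  let ?M = "lebesgue_on {0..T}"
  let ?c = "\<sigma>1 / (2 * real CARD('n))"
  let ?f = "\<lambda>z t. ?c * (\<Sum>i\<in>UNIV. (norm (z t $ i - xdata i t))\<^sup>2)"
  have meas: "?f z \<in> borel_measurable ?M" if "continuous_on {0..T} z" for z
  proof -
    have "(\<lambda>t. z t $ i) \<in> borel_measurable ?M" "xdata i \<in> borel_measurable ?M" for i
      using xdata[of i] that
      by (auto simp: square_integrable_def intro!: continuous_imp_measurable_on_sets_lebesgue continuous_intros)
    then show ?thesis by measurable
  qed
  have "(\<lambda>n. \<integral>t. ?f (X n) t \<partial>?M) \<longlonglongrightarrow> (\<integral>t. ?f x t \<partial>?M)"
  proof (rule integral_dominated_convergence)
    show "integrable ?M (\<lambda>t. ?c * (\<Sum>i\<in>UNIV. 2 * B\<^sup>2 + 2 * (norm (xdata i t))\<^sup>2))"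
      using xdata by (auto simp: square_integrable_def intro!: Bochner_Integration.integrable_add)
    show "AE t in ?M. (\<lambda>n. ?f (X n) t) \<longlonglongrightarrow> ?f x t"
      using lim by (auto intro!: AE_I2 tendsto_intros)
    show "AE t in ?M. norm (?f (X n) t) \<le> ?c * (\<Sum>i\<in>UNIV. 2 * B\<^sup>2 + 2 * (norm (xdata i t))\<^sup>2)" for n
    proof (rule AE_I2)
      fix t assume "t \<in> space ?M"
      then have t: "t \<in> {0..T}" by simp
      have le: "(norm (X n t $ i - xdata i t))\<^sup>2 \<le> 2 * B\<^sup>2 + 2 * (norm (xdata i t))\<^sup>2" for i
      proof -
        have "norm (X n t $ i) \<le> B"
          using X(2)[OF t] Finite_Cartesian_Product.norm_nth_le order_trans by blast
        then have "norm (X n t $ i - xdata i t) \<le> B + norm (xdata i t)"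
          using norm_triangle_ineq4[of "X n t $ i" "xdata i t"] by linarith
        then have "(norm (X n t $ i - xdata i t))\<^sup>2 \<le> (B + norm (xdata i t))\<^sup>2"
          by (rule power_mono) simp
        also have "\<dots> \<le> 2 * B\<^sup>2 + 2 * (norm (xdata i t))\<^sup>2"
          using sum_squares_bound[of B "norm (xdata i t)"] by (simp add: power2_sum)
        finally show ?thesis .
      qed
      have "norm (?f (X n) t) = ?f (X n) t"
        using \<open>\<sigma>1 \<ge> 0\<close> by (simp add: sum_nonneg)
      also have "\<dots> \<le> ?c * (\<Sum>i\<in>UNIV. 2 * B\<^sup>2 + 2 * (norm (xdata i t))\<^sup>2)"
        using \<open>\<sigma>1 \<ge> 0\<close> by (intro mult_left_mono sum_mono le) auto
      finally show "norm (?f (X n) t) \<le> ?c * (\<Sum>i\<in>UNIV. 2 * B\<^sup>2 + 2 * (norm (xdata i t))\<^sup>2)" .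
    qed
  qed (intro meas X x)+
  then show ?thesis
    unfolding cost_def fst_conv by (intro tendsto_intros u)
qed

section \<open>A priori bounds, a feasible pair and compactness of the solution set\<close>

locale interaction_system =
  fixes T \<tau> d a r \<epsilon> Amax Rmax :: real
    and w :: "'n::finite \<Rightarrow> real \<Rightarrow> real^2"
    and x0 v0 :: "'n \<Rightarrow> real^2"
  assumes T: "T > 0" and tau: "\<tau> > 0" and a: "a > 0" and r: "r > 0"
    and eps: "\<epsilon> < 1" and Amax: "Amax \<ge> 0" and Rmax: "Rmax \<ge> 0"
    and w: "\<And>i. continuous_on {0..T} (w i)"
begin

abbreviation "U \<equiv> admissible_params \<epsilon> Amax Rmax"
abbreviation "solves \<equiv> solves_system T \<tau> d a r w x0 v0"
abbreviation "acc \<equiv> acceleration \<tau> d a r w"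

text \<open>The pair forces are bounded over the parameter box and \<open>w\<close> is bounded on
  \<open>[0, T]\<close>; only the damping term grows, with slope \<open>\<tau>\<close> in the
  velocity. Hence one \<open>C\<close> serves all admissible parameters, times and states.\<close>

lemma norm_acceleration_le:
  obtains C where "C \<ge> 0"
    "\<And>u t z. u \<in> U \<Longrightarrow> t \<in> {0..T} \<Longrightarrow> norm (acc u t z) \<le> C + \<tau> * norm (snd z)"
proof -
  have "\<exists>B. \<forall>t\<in>{0..T}. norm (w i t) \<le> B" for i
    using compact_imp_bounded[OF compact_continuous_image[OF w compact_Icc]]
    unfolding bounded_iff by blast
  then obtain W where W: "\<And>i t. t \<in> {0..T} \<Longrightarrow> norm (w i t) \<le> W i" by metis
  define P where "P = exp_bound d a * Amax + exp_bound d r * Rmax"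
  have E: "exp_bound d a \<ge> 0" "exp_bound d r \<ge> 0"
    using a r by (auto simp: exp_bound_def)
  have "P \<ge> 0" using E Amax Rmax by (simp add: P_def)
  have P: "norm (pair_force d a r u i j z) \<le> P" if "u \<in> U" for u z and i j :: 'n
  proof -
    obtain lam A R where u: "u = (lam, A, R)" using prod_cases3 by blast
    with that have "\<bar>A\<bar> \<le> Amax" "\<bar>R\<bar> \<le> Rmax" by (auto simp: admissible_params_def)
    then have "exp_bound d a * \<bar>A\<bar> + exp_bound d r * \<bar>R\<bar> \<le> P"
      unfolding P_def using E by (intro add_mono mult_left_mono) auto
    with norm_pair_force_le[OF a r, of d lam A R i j z] show ?thesis by (simp add: u)
  qed
  let ?N = "real CARD('n)"
  \<comment> \<open>A crude constant: the prefactor \<open>1 / ?N\<close> is estimated by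
    \<open>1\<close>, and the norm of the vector by the sum of the norms of its components.\<close>
  define C where "C = (\<Sum>i\<in>UNIV. \<tau> * W i + ?N * P)"
  have W_nonneg: "W i \<ge> 0" for i
    using order_trans[OF norm_ge_zero W[of 0 i]] T by simp
  have "C \<ge> 0" unfolding C_def using tau W_nonneg \<open>P \<ge> 0\<close> by (intro sum_nonneg) simp
  moreover have "norm (acc u t z) \<le> C + \<tau> * norm (snd z)" if u: "u \<in> U" and t: "t \<in> {0..T}" for u t z
  proof -
    define y where "y i = \<tau> *\<^sub>R w i t - (1 / ?N) *\<^sub>R (\<Sum>j\<in>UNIV - {i}. pair_force d a r u i j z)" for i
    have "norm (y i) \<le> \<tau> * W i + ?N * P" for i
    proof -
      have "norm (\<Sum>j\<in>UNIV - {i}. pair_force d a r u i j z) \<le> (\<Sum>j\<in>UNIV - {i}. P)"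
        by (intro order_trans[OF norm_sum] sum_mono P u)
      also have "\<dots> \<le> (\<Sum>j\<in>(UNIV::'n set). P)"
        using \<open>P \<ge> 0\<close> by (intro sum_mono2) auto
      finally have S: "norm (\<Sum>j\<in>UNIV - {i}. pair_force d a r u i j z) \<le> ?N * P" by simp
      have "norm (y i) \<le> norm (\<tau> *\<^sub>R w i t)
          + norm ((1 / ?N) *\<^sub>R (\<Sum>j\<in>UNIV - {i}. pair_force d a r u i j z))"
        unfolding y_def by (rule norm_triangle_ineq4)
      also have "\<dots> \<le> \<tau> * W i + 1 * (?N * P)"
        unfolding norm_scaleR using tau W[OF t] S by (intro add_mono mult_mono) (auto simp: Suc_le_eq)
      finally show ?thesis by simp
    qed
    then have "(\<Sum>i\<in>UNIV. norm ((\<chi> i. y i) $ i)) \<le> C"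
      unfolding C_def vec_lambda_beta by (rule sum_mono)
    then have "norm (\<chi> i. y i) \<le> C"
      by (rule order_trans[OF norm_vec_le_sum])
    moreover have "acc u t z = (\<chi> i. y i) - \<tau> *\<^sub>R snd z"
      by (simp add: acceleration_def y_def vec_eq_iff algebra_simps)
    ultimately show ?thesis
      using norm_triangle_ineq4[of "\<chi> i. y i" "\<tau> *\<^sub>R snd z"] tau by simp
  qed
  ultimately show ?thesis by (rule that)
qed

text \<open>The acceleration bound involves the velocity but not the position, so the estimate for
  \<open>v\<close> closes by itself. The acceleration is then bounded, and \<open>x\<close> is
  controlled through its derivative \<open>v\<close>. One constant \<open>B\<close> covers sizes and
  Lipschitz constants of all admissible solutions.\<close>

lemma solution_bounds:
  obtains B where "\<And>u x v t. u \<in> U \<Longrightarrow> (x, v) \<in> state_space T \<Longrightarrow> solves u (x, v) \<Longrightarrow> t \<in> {0..T} \<Longrightarrow>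
      norm (x t) \<le> B \<and> norm (v t) \<le> B \<and> norm (acc u t (x t, v t)) \<le> B"
    and "\<And>u x v s t. u \<in> U \<Longrightarrow> (x, v) \<in> state_space T \<Longrightarrow> solves u (x, v) \<Longrightarrow> s \<in> {0..T} \<Longrightarrow> t \<in> {0..T} \<Longrightarrow>
      norm (x t - x s) \<le> B * \<bar>t - s\<bar> \<and> norm (v t - v s) \<le> B * \<bar>t - s\<bar>"
proof -
  obtain C where C: "C \<ge> 0"
    "\<And>u t z. u \<in> U \<Longrightarrow> t \<in> {0..T} \<Longrightarrow> norm (acc u t z) \<le> C + \<tau> * norm (snd z)"
    using norm_acceleration_le by blast
  define Bv where "Bv = 2 * (norm (\<chi> i. v0 i) + C * T) * exp (2 * \<tau> * T)"
  define Bx where "Bx = norm (\<chi> i. x0 i) + Bv * T"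
  define Ba where "Ba = C + \<tau> * Bv"
  have "Bv \<ge> 0" unfolding Bv_def using \<open>C \<ge> 0\<close> T by simp
  have all: "norm (x t) \<le> Bx \<and> norm (v t) \<le> Bv \<and> norm (acc u t (x t, v t)) \<le> Ba \<and>
      norm (x t - x s) \<le> Bv * \<bar>t - s\<bar> \<and> norm (v t - v s) \<le> Ba * \<bar>t - s\<bar>"
    if u: "u \<in> U" and y: "(x, v) \<in> state_space T" and sol: "solves u (x, v)"
      and st: "s \<in> {0..T}" "t \<in> {0..T}" for u x v s t
  proof -
    \<comment> \<open>Membership in \<open>H1\<close> selects the continuous representative; the
      integral identities alone do not control point values.\<close>
    have cont: "continuous_on {0..T} x" "continuous_on {0..T} v"
      using y by (auto simp: state_space_def H1_def)
    have weak: "has_weak_derivative T x v" "has_weak_derivative T v (\<lambda>t. acc u t (x t, v t))"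
      and init: "x 0 = (\<chi> i. x0 i)" "v 0 = (\<chi> i. v0 i)"
      using sol by (auto simp: vec_eq_iff)
    have v: "norm (v t) \<le> Bv" if "t \<in> {0..T}" for t
      unfolding Bv_def init(2)[symmetric]
      by (rule weak_derivative_linear_growth_bound[OF T tau C(1) cont(2) weak(2) _ that])
        (use C(2)[OF u] in fastforce)
    have acc: "norm (acc u t (x t, v t)) \<le> Ba" if "t \<in> {0..T}" for t
    proof -
      have "norm (acc u t (x t, v t)) \<le> C + \<tau> * norm (v t)"
        using C(2)[OF u that, of "(x t, v t)"] by simp
      also have "\<dots> \<le> Ba"
        unfolding Ba_def using v[OF that] tau by simp
      finally show ?thesis .
    qed
    have x_lip: "norm (x t - x s) \<le> Bv * \<bar>t - s\<bar>" if "s \<in> {0..T}" "t \<in> {0..T}" for s t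
      using weak_derivative_bounded_imp_lipschitz[OF cont(1) weak(1) v that] .
    have v_lip: "norm (v t - v s) \<le> Ba * \<bar>t - s\<bar>"
      using weak_derivative_bounded_imp_lipschitz[OF cont(2) weak(2) acc st] .
    have "norm (x t) \<le> norm (x 0) + norm (x t - x 0)"
      by (metis add.commute diff_add_cancel norm_triangle_ineq)
    also have "norm (x t - x 0) \<le> Bv * \<bar>t - 0\<bar>"
      using x_lip[of 0 t] st T by simp
    also have "\<dots> \<le> Bv * T"
      using st \<open>Bv \<ge> 0\<close> by (intro mult_left_mono) auto
    finally have "norm (x t) \<le> Bx" by (simp add: Bx_def init)
    with v acc x_lip v_lip st show ?thesis by blast
  qed
  define B where "B = max Bx (max Bv Ba)"
  have le: "Bx \<le> B" "Bv \<le> B" "Ba \<le> B" by (auto simp: B_def)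
  show ?thesis
  proof (rule that[of B])
    fix u x v t assume *: "u \<in> U" "(x, v) \<in> state_space T" "solves u (x, v)" "t \<in> {0..T}"
    show "norm (x t) \<le> B \<and> norm (v t) \<le> B \<and> norm (acc u t (x t, v t)) \<le> B"
      using all[OF * *(4)] le by linarith
  next
    fix u x v s t
    assume *: "u \<in> U" "(x, v) \<in> state_space T" "solves u (x, v)" "s \<in> {0..T}" "t \<in> {0..T}"
    have "Bv * \<bar>t - s\<bar> \<le> B * \<bar>t - s\<bar>" "Ba * \<bar>t - s\<bar> \<le> B * \<bar>t - s\<bar>"
      using le by (auto intro!: mult_right_mono)
    with all[OF *] show "norm (x t - x s) \<le> B * \<bar>t - s\<bar> \<and> norm (v t - v s) \<le> B * \<bar>t - s\<bar>"
      by linarith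
  qed
qed

text \<open>At zero strengths the agents decouple into \<open>v' = \<tau> (W - v)\<close>, solved by
  variation of constants. The value \<open>lam = 0\<close> is admissible because
  \<open>\<epsilon> < 1\<close>.\<close>

lemma ex_solution_without_interaction:
  obtains y where "y \<in> state_space T" "(0, 0, 0) \<in> U" "solves (0, 0, 0) y"
proof -
  define W where "W s = (\<chi> i. w i s)" for s
  have W: "continuous_on {0..T} W"
    unfolding W_def by (intro continuous_on_vec_lambda w)
  \<comment> \<open>The inhomogeneity \<open>\<tau> *\<^sub>R W s\<close> multiplied by the
    integrating factor \<open>exp (\<tau> * s)\<close>.\<close>
  define I where "I t = integral {0..t} (\<lambda>s. exp (\<tau> * s) *\<^sub>R \<tau> *\<^sub>R W s)" for t
  define v where "v t = exp (- \<tau> * t) *\<^sub>R ((\<chi> i. v0 i) + I t)" for t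
  define x where "x t = (\<chi> i. x0 i) + integral {0..t} v" for t
  have I': "(I has_vector_derivative (exp (\<tau> * t) *\<^sub>R \<tau> *\<^sub>R W t)) (at t within {0..T})"
    if "t \<in> {0..T}" for t
    unfolding I_def by (intro integral_has_vector_derivative continuous_intros W that)
  have v': "(v has_vector_derivative \<tau> *\<^sub>R (W t - v t)) (at t within {0..T})"
    if t: "t \<in> {0..T}" for t
  proof -
    have "((\<lambda>t. exp (- \<tau> * t)) has_real_derivative (- \<tau> * exp (- \<tau> * t))) (at t within {0..T})"
      by (auto intro!: derivative_eq_intros)
    moreover have "((\<lambda>t. (\<chi> i. v0 i) + I t) has_vector_derivative (exp (\<tau> * t) *\<^sub>R \<tau> *\<^sub>R W t)) (at t within {0..T})"
      using has_vector_derivative_add[OF has_vector_derivative_const I'[OF t]] by simp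
    ultimately have "((\<lambda>t. exp (- \<tau> * t) *\<^sub>R ((\<chi> i. v0 i) + I t)) has_vector_derivative
        (exp (- \<tau> * t) *\<^sub>R (exp (\<tau> * t) *\<^sub>R \<tau> *\<^sub>R W t)
          + (- \<tau> * exp (- \<tau> * t)) *\<^sub>R ((\<chi> i. v0 i) + I t))) (at t within {0..T})"
      by (rule has_vector_derivative_scaleR)
    moreover have "exp (- \<tau> * t) *\<^sub>R (exp (\<tau> * t) *\<^sub>R \<tau> *\<^sub>R W t)
          + (- \<tau> * exp (- \<tau> * t)) *\<^sub>R ((\<chi> i. v0 i) + I t) = \<tau> *\<^sub>R (W t - v t)"
      by (simp add: v_def exp_minus scaleR_diff_right)
    ultimately show ?thesis by (simp add: v_def[abs_def])
  qed
  have v_cont: "continuous_on {0..T} v"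
    by (rule continuous_on_vector_derivative[OF v'])
  have x': "(x has_vector_derivative v t) (at t within {0..T})" if t: "t \<in> {0..T}" for t
    using has_vector_derivative_add[OF has_vector_derivative_const integral_has_vector_derivative[OF v_cont t]]
    unfolding x_def[abs_def] by simp
  have x_cont: "continuous_on {0..T} x"
    by (rule continuous_on_vector_derivative[OF x'])
  have acc: "acc (0, 0, 0) t z = \<tau> *\<^sub>R (W t - snd z)" for t z
    by (simp add: acceleration_def pair_force_zero W_def vec_eq_iff)
  have weak: "has_weak_derivative T x v" "has_weak_derivative T v (\<lambda>t. \<tau> *\<^sub>R (W t - v t))"
    using x' v' v_cont W
    by (auto intro!: has_weak_derivative_of_vector_derivative[OF T] continuous_intros)
  show ?thesis
  proof (rule that[of "(x, v)"])
    show "(x, v) \<in> state_space T"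
      using weak x_cont v_cont by (auto simp: state_space_def H1_def)
    show "(0, 0, 0) \<in> U"
      using eps Amax Rmax by (simp add: admissible_params_def)
    show "solves (0, 0, 0) (x, v)"
      using weak by (simp add: acc) (simp add: x_def v_def I_def)
  qed
qed

text \<open>Continuity of the forces is assumed in the state for each fixed parameter; joint
  convergence is assembled inside the proof. The bound \<open>B\<close> is returned for the
  dominated convergence of the cost.\<close>

lemma solutions_compact:
  assumes force_cont: "\<And>u (i::'n) j. u \<in> U \<Longrightarrow> i \<noteq> j \<Longrightarrow>
      continuous_on (closure (visited_states T \<tau> d a r w x0 v0 U)) (pair_force d a r u i j)"
    and u: "\<And>n. u n \<in> U" and y: "\<And>n. (X n, V n) \<in> state_space T"
    and sol: "\<And>n. solves (u n) (X n, V n)"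
  obtains k :: "nat \<Rightarrow> nat" and us x v B where "strict_mono k" "us \<in> U" "(x, v) \<in> state_space T"
    "solves us (x, v)" "(\<lambda>n. u (k n)) \<longlonglongrightarrow> us"
    "\<And>t. t \<in> {0..T} \<Longrightarrow> (\<lambda>n. X (k n) t) \<longlonglongrightarrow> x t"
    "\<And>n t. t \<in> {0..T} \<Longrightarrow> norm (X n t) \<le> B"
proof -
  obtain B where B: "\<And>u x v t. u \<in> U \<Longrightarrow> (x, v) \<in> state_space T \<Longrightarrow> solves u (x, v) \<Longrightarrow> t \<in> {0..T} \<Longrightarrow>
      norm (x t) \<le> B \<and> norm (v t) \<le> B \<and> norm (acc u t (x t, v t)) \<le> B"
    and L: "\<And>u x v s t. u \<in> U \<Longrightarrow> (x, v) \<in> state_space T \<Longrightarrow> solves u (x, v) \<Longrightarrow> s \<in> {0..T} \<Longrightarrow> t \<in> {0..T} \<Longrightarrow>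
      norm (x t - x s) \<le> B * \<bar>t - s\<bar> \<and> norm (v t - v s) \<le> B * \<bar>t - s\<bar>"
    using solution_bounds by metis
  note B = B[OF u y sol] and L = L[OF u y sol]
  have "compact U"
    unfolding admissible_params_def by (intro compact_Times compact_Icc)
  then obtain us k1 where us: "us \<in> U" and k1: "strict_mono k1" and u_lim: "(u \<circ> k1) \<longlonglongrightarrow> us"
    using u unfolding compact_def by metis
  \<comment> \<open>Positions and velocities are paired so that a single application of
    Arzela-Ascoli, along the subsequence on which the parameters already converge, gives a common
    subsequence.\<close>
  define Z where "Z n t = (X (k1 n) t, V (k1 n) t)" for n t
  have "norm (X 0 0) \<le> B" using B[of 0 0] T by simp
  then have "B \<ge> 0" by (rule order_trans[OF norm_ge_zero])
  have Z_bound: "norm (Z n t) \<le> B + B" if "t \<in> {0..T}" for n t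
    unfolding Z_def using B[OF that, of "k1 n"] by (intro order_trans[OF norm_Pair_le]) auto
  \<comment> \<open>The Lipschitz constant of the pair is \<open>2 * B\<close>; the added
    \<open>1\<close> keeps the denominator positive when \<open>B = 0\<close>.\<close>
  have equicont: "\<exists>\<delta>>0. \<forall>n s. s \<in> {0..T} \<and> norm (t - s) < \<delta> \<longrightarrow> norm (Z n t - Z n s) < e"
    if "t \<in> {0..T}" "e > 0" for t e
  proof (intro exI[of _ "e / (2 * B + 1)"] conjI allI impI)
    show "e / (2 * B + 1) > 0" using \<open>B \<ge> 0\<close> \<open>e > 0\<close> by simp
    fix n s assume s: "s \<in> {0..T} \<and> norm (t - s) < e / (2 * B + 1)"
    have "norm (Z n t - Z n s) \<le> norm (X (k1 n) t - X (k1 n) s) + norm (V (k1 n) t - V (k1 n) s)"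
      unfolding Z_def diff_Pair by (rule norm_Pair_le)
    also have "\<dots> \<le> 2 * B * \<bar>t - s\<bar>"
      using L[of s t "k1 n"] s that by simp
    also have "\<dots> \<le> (2 * B + 1) * \<bar>t - s\<bar>"
      by (simp add: algebra_simps)
    also have "\<dots> < e"
      using s \<open>B \<ge> 0\<close> by (simp add: less_divide_eq mult.commute)
    finally show "norm (Z n t - Z n s) < e" .
  qed
  obtain z k2 where z_cont: "continuous_on {0..T} z" and k2: "strict_mono (k2 :: nat \<Rightarrow> nat)"
    and z: "\<And>e. 0 < e \<Longrightarrow> \<exists>N. \<forall>n t. n \<ge> N \<and> t \<in> {0..T} \<longrightarrow> norm (Z (k2 n) t - z t) < e"
    using Arzela_Ascoli[of "{0..T}" Z, OF compact_Icc Z_bound equicont] by blast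
  define k where "k = k1 \<circ> k2"
  have Z_eq: "Z (k2 n) t = (X (k n) t, V (k n) t)" for n t
    by (simp add: Z_def k_def)
  have Z_lim: "(\<lambda>n. (X (k n) t, V (k n) t)) \<longlonglongrightarrow> z t" if "t \<in> {0..T}" for t
    using z that unfolding LIMSEQ_iff Z_eq by blast
  define x where "x t = fst (z t)" for t
  define v where "v t = snd (z t)" for t
  have z_eq: "z t = (x t, v t)" for t by (simp add: x_def v_def)
  have X_lim: "(\<lambda>n. X (k n) t) \<longlonglongrightarrow> x t" and V_lim: "(\<lambda>n. V (k n) t) \<longlonglongrightarrow> v t" if "t \<in> {0..T}" for t
    using tendsto_fst[OF Z_lim[OF that]] tendsto_snd[OF Z_lim[OF that]] by (simp_all add: x_def v_def)
  have uk_lim: "(\<lambda>n. u (k n)) \<longlonglongrightarrow> us"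
    using LIMSEQ_subseq_LIMSEQ[OF u_lim k2] by (simp add: k_def o_def)
  let ?S = "visited_states T \<tau> d a r w x0 v0 U"
  have visited: "(X (k n) t, V (k n) t) \<in> ?S" if "t \<in> {0..T}" for n t
    unfolding visited_states_def using that u y sol by blast
  have force_lim: "(\<lambda>n. pair_force d a r (u (k n)) i j (X (k n) t, V (k n) t)) \<longlonglongrightarrow> pair_force d a r us i j (x t, v t)"
    if t: "t \<in> {0..T}" and ij: "i \<noteq> j" for t i j
  proof -
    have mem: "(X (k n) t, V (k n) t) \<in> closure ?S" for n
      using visited[OF t] closure_subset by blast
    \<comment> \<open>At this point \<open>z\<close> is not known to be a solution, so its values
      are placed only in the closure of the visited states. Continuity there handles the moving
      state at the fixed parameter \<open>us\<close>; the parameter error is added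
      afterwards.\<close>
    have "z t \<in> closure ?S"
      by (rule closed_sequentially[OF closed_closure mem Z_lim[OF t]])
    then have "(\<lambda>n. pair_force d a r us i j (X (k n) t, V (k n) t)) \<longlonglongrightarrow> pair_force d a r us i j (z t)"
      using mem by (intro continuous_on_tendsto_compose[OF force_cont[OF us ij] Z_lim[OF t]]) auto
    from tendsto_add[OF this pair_force_params_tendsto[OF a r uk_lim, where z = "\<lambda>n. (X (k n) t, V (k n) t)" and d = d and i = i and j = j]]
    show ?thesis by (simp add: z_eq)
  qed
  have acc_lim: "(\<lambda>n. acc (u (k n)) t (X (k n) t, V (k n) t)) \<longlonglongrightarrow> acc us t (x t, v t)"
    if t: "t \<in> {0..T}" for t
    unfolding acceleration_def snd_conv
    by (intro tendsto_vec_lambda tendsto_intros force_lim V_lim t) auto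
  have weak: "has_weak_derivative T (X n) (V n)" "has_weak_derivative T (V n) (\<lambda>t. acc (u n) t (X n t, V n t))"
    for n
    using sol[of n] by simp_all
  have weak_x: "has_weak_derivative T x v"
    by (rule has_weak_derivative_limit[OF weak(1) X_lim V_lim]) (use B in blast)+
  have weak_v: "has_weak_derivative T v (\<lambda>t. acc us t (x t, v t))"
    by (rule has_weak_derivative_limit[OF weak(2) V_lim acc_lim]) (use B in blast)+
  have "X n 0 = (\<chi> i. x0 i)" "V n 0 = (\<chi> i. v0 i)" for n
    using sol[of n] by (auto simp: vec_eq_iff)
  then have "x 0 = (\<chi> i. x0 i)" "v 0 = (\<chi> i. v0 i)"
    using X_lim[of 0] V_lim[of 0] T by (auto simp: LIMSEQ_const_iff)
  then have "solves us (x, v)"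
    using weak_x weak_v by simp
  moreover have "(x, v) \<in> state_space T"
    using weak_x weak_v z_cont
    by (auto simp: state_space_def H1_def x_def[abs_def] v_def[abs_def] intro!: continuous_intros)
  moreover have "strict_mono k"
    unfolding k_def by (rule strict_mono_o[OF k1 k2])
  ultimately show ?thesis
    using that[OF _ us _ _ uk_lim X_lim] B by blast
qed

end

section \<open>Attainment of the infimum\<close>

theorem theorem2:
  fixes T \<tau> d a r \<epsilon> Amax Rmax \<sigma>1 \<sigma>2 :: real
    and w :: "'n::finite \<Rightarrow> real \<Rightarrow> real^2"
    and x0 v0 :: "'n \<Rightarrow> real^2"
    and xdata :: "'n \<Rightarrow> real \<Rightarrow> real^2"
    and uref :: params
  assumes "T > 0" and "\<tau> > 0" and "d > 0" and "a > 0" and "r > 0"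
    and "0 < \<epsilon>" and "\<epsilon> < 1" and "Amax \<ge> 0" and "Rmax \<ge> 0"
    and "\<sigma>1 \<ge> 0" and "\<sigma>2 \<ge> 0"
    and "\<And>i. continuous_on {0..T} (w i)"
    and "\<And>i. square_integrable T (xdata i)"
    and force_bounded:
      "\<And>u (i::'n) j. u \<in> admissible_params \<epsilon> Amax Rmax \<Longrightarrow> i \<noteq> j \<Longrightarrow>
         bounded (range (pair_force d a r u i j))"
    and force_locally_lipschitz:
      "\<And>u (i::'n) j. u \<in> admissible_params \<epsilon> Amax Rmax \<Longrightarrow> i \<noteq> j \<Longrightarrow>
         local_lipschitz {u}
           (closure (visited_states T \<tau> d a r w x0 v0 (admissible_params \<epsilon> Amax Rmax)))
           (\<lambda>u. pair_force d a r u i j)"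
  shows "\<exists>ystar ustar.
     is_arg_min (\<lambda>(y, u). cost T \<sigma>1 \<sigma>2 xdata uref y u)
       (\<lambda>(y, u). (y, u) \<in> state_space T \<times> admissible_params \<epsilon> Amax Rmax \<and>
                 solves_system T \<tau> d a r w x0 v0 u y)
       (ystar, ustar)"
proof -
  interpret interaction_system T \<tau> d a r \<epsilon> Amax Rmax w x0 v0
    by (rule interaction_system.intro) (rule assms)+
  define feasible where "feasible = {(y, u). y \<in> state_space T \<and> u \<in> U \<and> solves u y}"
  define J where "J = (\<lambda>(y, u). cost T \<sigma>1 \<sigma>2 xdata uref y u)"
  obtain y where "y \<in> state_space T" "(0, 0, 0) \<in> U" "solves (0, 0, 0) y"
    by (rule ex_solution_without_interaction)
  then have "(y, (0, 0, 0)) \<in> feasible" unfolding feasible_def by simp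
  then have "feasible \<noteq> {}" by blast
  moreover have bdd: "bdd_below (J ` feasible)"
    unfolding J_def
    by (auto intro!: bdd_belowI[of _ 0] cost_nonneg[OF \<open>\<sigma>1 \<ge> 0\<close> \<open>\<sigma>2 \<ge> 0\<close>] simp del: prod.collapse)
  ultimately have "Inf (J ` feasible) \<in> closure (J ` feasible)"
    by (intro closure_contains_Inf) auto
  then obtain c where c: "\<And>n. c n \<in> J ` feasible" "c \<longlonglongrightarrow> Inf (J ` feasible)"
    unfolding closure_sequential by blast
  have "\<forall>n. \<exists>q\<in>feasible. c n = J q"
    using c(1) by blast
  then obtain p where p: "\<And>n. p n \<in> feasible" "\<And>n. c n = J (p n)"
    by metis
  define X where "X n = fst (fst (p n))" for n
  define V where "V n = snd (fst (p n))" for n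
  define u where "u n = snd (p n)" for n
  have p_eq: "p n = ((X n, V n), u n)" for n by (simp add: X_def V_def u_def)
  have feas: "u n \<in> U" "(X n, V n) \<in> state_space T" "solves (u n) (X n, V n)" for n
    using p(1)[of n] unfolding feasible_def p_eq by auto
  \<comment> \<open>The singleton \<open>{u}\<close> in the Lipschitz assumption freezes the
    parameter, so what results is continuity in the state for each admissible
    \<open>u\<close>.\<close>
  have "continuous_on (closure (visited_states T \<tau> d a r w x0 v0 U)) (pair_force d a r u i j)"
    if "u \<in> U" "i \<noteq> j" for u and i j :: 'n
    using local_lipschitz_continuous_on[OF force_locally_lipschitz[OF that]] by simp
  then obtain k :: "nat \<Rightarrow> nat" and us x v B where k: "strict_mono k"
    and lim: "us \<in> U" "(x, v) \<in> state_space T" "solves us (x, v)" "(\<lambda>n. u (k n)) \<longlonglongrightarrow> us"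
    "\<And>t. t \<in> {0..T} \<Longrightarrow> (\<lambda>n. X (k n) t) \<longlonglongrightarrow> x t"
    "\<And>n t. t \<in> {0..T} \<Longrightarrow> norm (X n t) \<le> B"
    by (rule solutions_compact[where u = u and X = X and V = V, OF _ feas]) blast+
  have "(\<lambda>n. cost T \<sigma>1 \<sigma>2 xdata uref (X (k n), V (k n)) (u (k n))) \<longlonglongrightarrow> cost T \<sigma>1 \<sigma>2 xdata uref (x, v) us"
  proof (rule cost_tendsto)
    show "continuous_on {0..T} (X (k n))" for n
      using feas(2)[of "k n"] by (simp add: state_space_def H1_def)
    show "continuous_on {0..T} x"
      using lim(2) by (simp add: state_space_def H1_def)
    show "norm (X (k n) t) \<le> B" if "t \<in> {0..T}" for n t
      by (rule lim(6)[OF that])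
  qed (fact | rule lim(4,5) assms)+
  then have "(\<lambda>n. c (k n)) \<longlonglongrightarrow> J ((x, v), us)"
    by (simp add: p J_def p_eq)
  moreover have "(\<lambda>n. c (k n)) \<longlonglongrightarrow> Inf (J ` feasible)"
    using LIMSEQ_subseq_LIMSEQ[OF c(2) k] by (simp add: o_def)
  ultimately have "J ((x, v), us) = Inf (J ` feasible)"
    by (rule LIMSEQ_unique)
  then have "J ((x, v), us) \<le> J q" if "q \<in> feasible" for q
    using cInf_lower[OF imageI[OF that] bdd] by simp
  then have "is_arg_min J (\<lambda>q. q \<in> feasible) ((x, v), us)"
    using lim(1-3) unfolding is_arg_min_linorder feasible_def by simp
  then show ?thesis
    unfolding J_def feasible_def by (intro exI) (simp add: case_prod_unfold mem_Times_iff conj_assoc)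
qed

end
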